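(* Every finite object $X$ of $\mathcal{F}_{\mathcal{G}r}$ is polynomial, i.e. there exists an integer $n$ such that $(\Delta^{\mathcal{G}r})^n(X)=0$.
   Context: $\Bbbk$ is a finite field; $\mathcal{E}$ is the category of $\Bbbk$-vector spaces, $\mathcal{E}^f$ the full subcategory of finite-dimensional ones. $\mathcal{E}^f_{\mathcal{G}r}$ is the category of pairs $(V,W)$ with $V\in\mathcal{E}^f$ and $W$ a linear subspace of $V$, morphisms $(V,W)\to(V',W')$ being linear maps $f:V\to V'$ with $f(W)=W'$. $\mathcal{F}_{\mathcal{G}r}$ is the abelian category of functors $\mathcal{E}^f_{\mathcal{G}r}\to\mathcal{E}$. An object of an abelian category is finite if it has finite length (a finite filtration with simple subquotients). The difference functor $\Delta^{\mathcal{G}r}:\mathcal{F}_{\mathcal{G}r}\to\mathcal{F}_{\mathcal{G}r}$ is defined by the canonical splitting $X(V\oplus\Bbbk,W)\simeq X(V,W)\oplus\Delta^{\mathcal{G}r}(X)(V,W)$; that is, $\Delta^{\mathcal{G}r}(X)(V,W)$ is the kernel of the map $X(V\oplus\Bbbk,W)\to X(V,W)$ induced by the projection $V\oplus\Bbbk\to V$ (where $W\subset V\subset V\oplus \Bbbk$). *)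

theory Defs
  imports "HOL-Algebra.AbelCoset" "Jordan_Normal_Form.Missing_VectorSpace"
begin

section \<open>Finite-dimensional vector spaces with a distinguished subspace\<close>

text \<open>
  Vector spaces over a field \<open>K\<close> are records with a carrier set, and linear maps are
  taken extensional, so that equality of functions is equality of morphisms.
\<close>

definition linear_maps ::
  "('k, 'r) ring_scheme \<Rightarrow> ('k, 'a) module \<Rightarrow> ('k, 'b) module \<Rightarrow> ('a \<Rightarrow> 'b) set"
  where "linear_maps K M N = module_hom K M N \<inter> extensional (carrier M)"

type_synonym ('k, 'v) gr_pair = "('k, 'v) module \<times> 'v set"

definition gr_ob :: "('k, 'r) ring_scheme \<Rightarrow> ('k, 'v) gr_pair set"
  where "gr_ob K =
    {(V, W). vectorspace K V \<and> vectorspace.fin_dim K V \<and> subspace K W V}"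

definition gr_hom ::
  "('k, 'r) ring_scheme \<Rightarrow> ('k, 'v) gr_pair \<Rightarrow> ('k, 'v) gr_pair \<Rightarrow> ('v \<Rightarrow> 'v) set"
  where "gr_hom K A B = {f \<in> linear_maps K (fst A) (fst B). f ` snd A = snd B}"

definition gr_id :: "('k, 'v) gr_pair \<Rightarrow> 'v \<Rightarrow> 'v"
  where "gr_id A = (\<lambda>v\<in>carrier (fst A). v)"

definition gr_comp :: "('k, 'v) gr_pair \<Rightarrow> ('v \<Rightarrow> 'v) \<Rightarrow> ('v \<Rightarrow> 'v) \<Rightarrow> 'v \<Rightarrow> 'v"
  where "gr_comp A g f = compose (carrier (fst A)) g f"


section \<open>Functors to vector spaces of arbitrary dimension\<close>

record ('k, 'v, 'w) gr_functor =
  ob :: "('k, 'v) gr_pair \<Rightarrow> ('k, 'w) module"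
  mor :: "('k, 'v) gr_pair \<Rightarrow> ('k, 'v) gr_pair \<Rightarrow> ('v \<Rightarrow> 'v) \<Rightarrow> 'w \<Rightarrow> 'w"

locale gr_functor =
  fixes K :: "('k, 'r) ring_scheme" and X :: "('k, 'v, 'w) gr_functor"
  assumes ob_vectorspace: "A \<in> gr_ob K \<Longrightarrow> vectorspace K (ob X A)"
    and mor_linear: "\<lbrakk>A \<in> gr_ob K; B \<in> gr_ob K; f \<in> gr_hom K A B\<rbrakk> \<Longrightarrow>
      mor X A B f \<in> linear_maps K (ob X A) (ob X B)"
    and mor_id: "A \<in> gr_ob K \<Longrightarrow> mor X A A (gr_id A) = (\<lambda>x\<in>carrier (ob X A). x)"
    and mor_comp: "\<lbrakk>A \<in> gr_ob K; B \<in> gr_ob K; C \<in> gr_ob K; f \<in> gr_hom K A B; g \<in> gr_hom K B C\<rbrakk> \<Longrightarrow>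
      mor X A C (gr_comp A g f) = compose (carrier (ob X A)) (mor X B C g) (mor X A B f)"

definition zero_functor :: "('k, 'r) ring_scheme \<Rightarrow> ('k, 'v, 'w) gr_functor \<Rightarrow> bool"
  where "zero_functor K X \<longleftrightarrow> (\<forall>A\<in>gr_ob K. carrier (ob X A) = {\<zero>\<^bsub>ob X A\<^esub>})"


section \<open>Finite objects\<close>

text \<open>A subobject of \<open>X\<close> is given by the family of its values, as subspaces of the values of \<open>X\<close>.\<close>

definition subfunctor ::
  "('k, 'r) ring_scheme \<Rightarrow> ('k, 'v, 'w) gr_functor \<Rightarrow> (('k, 'v) gr_pair \<Rightarrow> 'w set) \<Rightarrow> bool"
  where "subfunctor K X Y \<longleftrightarrow>
    (\<forall>A\<in>gr_ob K. subspace K (Y A) (ob X A)) \<and>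
    (\<forall>A\<in>gr_ob K. \<forall>B\<in>gr_ob K. \<forall>f\<in>gr_hom K A B. mor X A B f ` Y A \<subseteq> Y B)"

definition sub_functor ::
  "('k, 'v, 'w) gr_functor \<Rightarrow> (('k, 'v) gr_pair \<Rightarrow> 'w set) \<Rightarrow> ('k, 'v, 'w) gr_functor"
  where "sub_functor X Y =
    \<lparr>ob = (\<lambda>A. (ob X A)\<lparr>carrier := Y A\<rparr>),
     mor = (\<lambda>A B f. restrict (mor X A B f) (Y A))\<rparr>"

text \<open>
  The quotient of \<open>M\<close> by \<open>U\<close> consists of the cosets of \<open>U\<close>. The fields \<open>mult\<close> and \<open>one\<close> that
  module records inherit from ring records play no role.
\<close>

definition quot_space :: "('k, 'w) module \<Rightarrow> 'w set \<Rightarrow> ('k, 'w set) module"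
  where "quot_space M U =
    \<lparr>carrier = a_rcosets\<^bsub>M\<^esub> U,
     mult = undefined,
     one = undefined,
     zero = U,
     add = (\<lambda>C D. C <+>\<^bsub>M\<^esub> D),
     smult = (\<lambda>a C. \<Union>x\<in>C. U +>\<^bsub>M\<^esub> (a \<odot>\<^bsub>M\<^esub> x))\<rparr>"

definition quot_functor ::
  "('k, 'v, 'w) gr_functor \<Rightarrow> (('k, 'v) gr_pair \<Rightarrow> 'w set) \<Rightarrow> ('k, 'v, 'w set) gr_functor"
  where "quot_functor X Y =
    \<lparr>ob = (\<lambda>A. quot_space (ob X A) (Y A)),
     mor = (\<lambda>A B f. \<lambda>C\<in>carrier (quot_space (ob X A) (Y A)).
       \<Union>x\<in>C. Y B +>\<^bsub>ob X B\<^esub> mor X A B f x)\<rparr>"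

definition simple_functor :: "('k, 'r) ring_scheme \<Rightarrow> ('k, 'v, 'w) gr_functor \<Rightarrow> bool"
  where "simple_functor K S \<longleftrightarrow>
    \<not> zero_functor K S \<and>
    (\<forall>Y. subfunctor K S Y \<longrightarrow>
      (\<forall>A\<in>gr_ob K. Y A = {\<zero>\<^bsub>ob S A\<^esub>}) \<or> (\<forall>A\<in>gr_ob K. Y A = carrier (ob S A)))"

definition finite_object :: "('k, 'r) ring_scheme \<Rightarrow> ('k, 'v, 'w) gr_functor \<Rightarrow> bool"
  where "finite_object K X \<longleftrightarrow>
    (\<exists>n F. (\<forall>i\<le>n. subfunctor K X (F i)) \<and>
      (\<forall>A\<in>gr_ob K. F 0 A = {\<zero>\<^bsub>ob X A\<^esub>}) \<and>
      (\<forall>A\<in>gr_ob K. F n A = carrier (ob X A)) \<and>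
      (\<forall>i<n. (\<forall>A\<in>gr_ob K. F i A \<subseteq> F (Suc i) A) \<and>
        simple_functor K (quot_functor (sub_functor X (F (Suc i))) (F i))))"


section \<open>The difference functor\<close>

text \<open>
  To iterate the difference functor, the underlying type of the source spaces has to be closed
  under \<open>V \<mapsto> V \<oplus> K\<close>. So source spaces live in the following type, in which
  \<open>Adjoin v a\<close> stands for the pair \<open>(v, a)\<close>. Spaces with carrier in an arbitrary type \<open>'u\<close>
  are included through \<open>Atom\<close>; whatever \<open>'u\<close> is, every finite-dimensional space over \<open>K\<close>
  is isomorphic to one living in this type.
\<close>

datatype ('u, 'k) vec_univ =
    Atom 'u
  | Adjoin (vec_part: "('u, 'k) vec_univ") (scal_part: 'k)

definition adjoin_space ::
  "('k, 'r) ring_scheme \<Rightarrow> ('k, ('u, 'k) vec_univ) module \<Rightarrow> ('k, ('u, 'k) vec_univ) module"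
  where "adjoin_space K V =
    \<lparr>carrier = {Adjoin v a | v a. v \<in> carrier V \<and> a \<in> carrier K},
     mult = undefined,
     one = undefined,
     zero = Adjoin \<zero>\<^bsub>V\<^esub> \<zero>\<^bsub>K\<^esub>,
     add = (\<lambda>x y. Adjoin (vec_part x \<oplus>\<^bsub>V\<^esub> vec_part y) (scal_part x \<oplus>\<^bsub>K\<^esub> scal_part y)),
     smult = (\<lambda>c x. Adjoin (c \<odot>\<^bsub>V\<^esub> vec_part x) (c \<otimes>\<^bsub>K\<^esub> scal_part x))\<rparr>"

definition adjoin_ob ::
  "('k, 'r) ring_scheme \<Rightarrow> ('k, ('u, 'k) vec_univ) gr_pair \<Rightarrow> ('k, ('u, 'k) vec_univ) gr_pair"
  where "adjoin_ob K A = (adjoin_space K (fst A), (\<lambda>w. Adjoin w \<zero>\<^bsub>K\<^esub>) ` snd A)"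

definition adjoin_mor ::
  "('k, 'r) ring_scheme \<Rightarrow> ('k, ('u, 'k) vec_univ) gr_pair \<Rightarrow>
    (('u, 'k) vec_univ \<Rightarrow> ('u, 'k) vec_univ) \<Rightarrow> ('u, 'k) vec_univ \<Rightarrow> ('u, 'k) vec_univ"
  where "adjoin_mor K A f =
    (\<lambda>x\<in>carrier (fst (adjoin_ob K A)). Adjoin (f (vec_part x)) (scal_part x))"

definition adjoin_proj ::
  "('k, 'r) ring_scheme \<Rightarrow> ('k, ('u, 'k) vec_univ) gr_pair \<Rightarrow> ('u, 'k) vec_univ \<Rightarrow> ('u, 'k) vec_univ"
  where "adjoin_proj K A = (\<lambda>x\<in>carrier (fst (adjoin_ob K A)). vec_part x)"

definition diff_kernel ::
  "('k, 'r) ring_scheme \<Rightarrow> ('k, ('u, 'k) vec_univ, 'w) gr_functor \<Rightarrow>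
    ('k, ('u, 'k) vec_univ) gr_pair \<Rightarrow> 'w set"
  where "diff_kernel K X A =
    a_kernel (ob X (adjoin_ob K A)) (ob X A) (mor X (adjoin_ob K A) A (adjoin_proj K A))"

definition diff_functor ::
  "('k, 'r) ring_scheme \<Rightarrow> ('k, ('u, 'k) vec_univ, 'w) gr_functor \<Rightarrow>
    ('k, ('u, 'k) vec_univ, 'w) gr_functor"
  where "diff_functor K X =
    \<lparr>ob = (\<lambda>A. (ob X (adjoin_ob K A))\<lparr>carrier := diff_kernel K X A\<rparr>),
     mor = (\<lambda>A B f.
       restrict (mor X (adjoin_ob K A) (adjoin_ob K B) (adjoin_mor K A f)) (diff_kernel K X A))\<rparr>"

definition polynomial_functor ::
  "('k, 'r) ring_scheme \<Rightarrow> ('k, ('u, 'k) vec_univ, 'w) gr_functor \<Rightarrow> bool"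
  where "polynomial_functor K X \<longleftrightarrow> (\<exists>n. zero_functor K ((diff_functor K ^^ n) X))"

end

theory Submission
  imports Defs
begin


text \<open>
  Over a finite field every function on a finite set of linear maps is polynomial, so a functor
  generated by a single element takes polynomial values of bounded degree, and a polynomial of
  degree less than \<open>n\<close> in \<open>n\<close> adjoined coordinates is determined by its restrictions to the
  hyperplanes where one of these coordinates vanishes.

  In detail, let \<open>U \<subseteq> U'\<close> be successive terms of a composition series and pick \<open>x \<in> U'(B)\<close> outside
  \<open>U(B)\<close>. For \<open>y \<in> U'(T)\<close> consider the function \<open>f \<mapsto> X(f) y\<close> on \<open>Hom(T, B)\<close>, with values in
  \<open>X(B)\<close> modulo \<open>U(B)\<close>. For \<open>T = B\<close> and \<open>y = x\<close> it is a function on the finite set \<open>End(B)\<close>;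
  since linear forms separate the points of \<open>End(B)\<close>, Lagrange interpolation writes it with products
  of fewer than \<open>N = |End(B)|\<close> affine functions (\<open>deg_below_endomorphism_action\<close>). Having degree
  below \<open>N\<close> is stable under composition with morphisms, so the \<open>y\<close> with this property form a
  subfunctor; by simplicity of \<open>U'/U\<close> it contains all of \<open>U'\<close>. Dually, the \<open>y\<close> whose function
  vanishes identically form a subfunctor that misses \<open>x\<close>, and hence lie in \<open>U\<close>.

  An element \<open>y\<close> of the \<open>n\<close>-th difference of \<open>X\<close> at \<open>(V, W)\<close> is an element of
  \<open>X(V \<oplus> K\<^sup>n, W)\<close> which is killed by each of the idempotents that set one of the \<open>n\<close> new coordinates
  to zero. Composing a morphism \<open>f\<close> with products of these idempotents gives a cube of morphisms
  depending in an affine way on the vertex, and the function of \<open>y\<close> vanishes at all vertices but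
  \<open>f\<close> itself. Its value at \<open>f\<close> is therefore an \<open>n\<close>-fold difference, which is zero modulo
  \<open>U(B)\<close> once \<open>n \<ge> N\<close>. So \<open>y \<in> U'\<close> implies \<open>y \<in> U\<close> (\<open>simple_quotient_polynomial\<close>), and going down the
  composition series gives \<open>y = 0\<close>. The idempotents are morphisms because they fix
  the distinguished subspace \<open>W\<close> pointwise. As \<open>Hom(T, B)\<close> is in general not a subspace of the
  space of linear maps, degrees are measured on cubes of morphisms.
\<close>

section \<open>Functions of bounded degree on a cube\<close>

text \<open>
  The subsets \<open>I \<subseteq> D\<close> are the vertices of a cube with directions \<open>D\<close>. For finite \<open>D\<close> the condition
  says, in terms of the indicator variables of \<open>I\<close>, that \<open>g\<close> is a polynomial of degree at most
  one: each edge in direction \<open>i\<close> contributes the same vector.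
\<close>
definition affine_cube :: "('v, 'm) ring_scheme \<Rightarrow> 'i set \<Rightarrow> ('i set \<Rightarrow> 'v) \<Rightarrow> bool"
  where "affine_cube N D g \<longleftrightarrow>
    (\<forall>I\<subseteq>D. g I \<in> carrier N) \<and>
    (\<forall>i\<in>D. \<exists>h\<in>carrier N. \<forall>I\<subseteq>D - {i}. g (insert i I) = g I \<oplus>\<^bsub>N\<^esub> h)"

text \<open>
  \<open>G\<close> has degree less than \<open>m\<close> modulo \<open>U\<close> if its \<open>m\<close>-fold differences in distinct directions lie in
  \<open>U\<close>. Differences are taken along the cube itself because the cubes in view consist of
  morphisms, which cannot be added; working modulo a subspace stands in for functions with values
  in a quotient.
\<close>
primrec deg_below ::
  "('w, 'm) ring_scheme \<Rightarrow> 'w set \<Rightarrow> nat \<Rightarrow> 'i set \<Rightarrow> ('i set \<Rightarrow> 'w) \<Rightarrow> bool"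
  where
    "deg_below M U 0 D G \<longleftrightarrow> (\<forall>I\<subseteq>D. G I \<in> U)"
  | "deg_below M U (Suc m) D G \<longleftrightarrow>
      (\<forall>i\<in>D. deg_below M U m (D - {i}) (\<lambda>I. G I \<ominus>\<^bsub>M\<^esub> G (insert i I)))"

lemma deg_below_cong:
  "(\<And>I. I \<subseteq> D \<Longrightarrow> G I = H I) \<Longrightarrow> deg_below M U m D G \<longleftrightarrow> deg_below M U m D H"
proof (induction m arbitrary: D G H)
  case 0
  then show ?case by simp
next
  case (Suc m)
  have "deg_below M U m (D - {i}) (\<lambda>I. G I \<ominus>\<^bsub>M\<^esub> G (insert i I)) \<longleftrightarrow>
        deg_below M U m (D - {i}) (\<lambda>I. H I \<ominus>\<^bsub>M\<^esub> H (insert i I))" if "i \<in> D" for i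
  proof (rule Suc.IH)
    fix I assume "I \<subseteq> D - {i}"
    then have "I \<subseteq> D" "insert i I \<subseteq> D" using that by auto
    then show "G I \<ominus>\<^bsub>M\<^esub> G (insert i I) = H I \<ominus>\<^bsub>M\<^esub> H (insert i I)"
      using Suc.prems[of I] Suc.prems[of "insert i I"] by simp
  qed
  then show ?case by simp
qed

lemma deg_below_subset:
  "deg_below M U m D G \<Longrightarrow> D' \<subseteq> D \<Longrightarrow> deg_below M U m D' G"
proof (induction m arbitrary: D D' G)
  case (Suc m)
  have "deg_below M U m (D' - {i}) (\<lambda>I. G I \<ominus>\<^bsub>M\<^esub> G (insert i I))" if "i \<in> D'" for i
    by (rule Suc.IH[of "D - {i}"]) (use Suc.prems that in auto)
  then show ?case by simp
qed auto

lemma affine_cube_subset: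
  assumes "affine_cube N D g" "D' \<subseteq> D"
  shows "affine_cube N D' g"
  unfolding affine_cube_def
proof (intro conjI ballI allI impI)
  fix i assume "i \<in> D'"
  then obtain h where h: "h \<in> carrier N" "\<forall>I\<subseteq>D - {i}. g (insert i I) = g I \<oplus>\<^bsub>N\<^esub> h"
    using assms unfolding affine_cube_def by blast
  moreover have "I \<subseteq> D - {i}" if "I \<subseteq> D' - {i}" for I
    using that assms(2) by auto
  ultimately show "\<exists>h\<in>carrier N. \<forall>I\<subseteq>D' - {i}. g (insert i I) = g I \<oplus>\<^bsub>N\<^esub> h"
    by (intro bexI[of _ h]) simp_all
qed (use assms in \<open>auto simp: affine_cube_def\<close>)

lemma affine_cube_cong:
  assumes "\<And>I. I \<subseteq> D \<Longrightarrow> g I = g' I" "affine_cube N D g"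
  shows "affine_cube N D g'"
  unfolding affine_cube_def
proof (intro conjI ballI allI impI)
  fix i assume i: "i \<in> D"
  then obtain h where h: "h \<in> carrier N" "\<forall>I\<subseteq>D - {i}. g (insert i I) = g I \<oplus>\<^bsub>N\<^esub> h"
    using assms unfolding affine_cube_def by blast
  have "g' (insert i I) = g' I \<oplus>\<^bsub>N\<^esub> h" if "I \<subseteq> D - {i}" for I
  proof -
    have "I \<subseteq> D" "insert i I \<subseteq> D" using that i by auto
    then show ?thesis using h(2) that assms(1) by metis
  qed
  with h(1) show "\<exists>h\<in>carrier N. \<forall>I\<subseteq>D - {i}. g' (insert i I) = g' I \<oplus>\<^bsub>N\<^esub> h" by blast
qed (use assms in \<open>auto simp: affine_cube_def\<close>)

lemma affine_cube_additive_image: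
  assumes "affine_cube N D g" "l \<in> carrier N \<rightarrow> carrier N'"
    and "\<And>v w. v \<in> carrier N \<Longrightarrow> w \<in> carrier N \<Longrightarrow> l (v \<oplus>\<^bsub>N\<^esub> w) = l v \<oplus>\<^bsub>N'\<^esub> l w"
  shows "affine_cube N' D (\<lambda>I. l (g I))"
  unfolding affine_cube_def
proof (intro conjI ballI allI impI)
  fix i assume i: "i \<in> D"
  then obtain h where h: "h \<in> carrier N" "\<forall>I\<subseteq>D - {i}. g (insert i I) = g I \<oplus>\<^bsub>N\<^esub> h"
    using assms unfolding affine_cube_def by blast
  have "l (g (insert i I)) = l (g I) \<oplus>\<^bsub>N'\<^esub> l h" if "I \<subseteq> D - {i}" for I
  proof -
    have "g I \<in> carrier N" using assms(1) that unfolding affine_cube_def by blast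
    then show ?thesis using h that assms(3) by simp
  qed
  moreover have "l h \<in> carrier N'" using assms(2) h(1) by blast
  ultimately show "\<exists>h\<in>carrier N'. \<forall>I\<subseteq>D - {i}. l (g (insert i I)) = l (g I) \<oplus>\<^bsub>N'\<^esub> h" by blast
qed (use assms in \<open>auto simp: affine_cube_def\<close>)

context module
begin

lemma affine_cube_normalize:
  assumes "affine_cube R D c" "s \<in> carrier R" "t \<in> carrier R"
  shows "affine_cube R D (\<lambda>I. t \<otimes> (c I \<ominus> s))"
  unfolding affine_cube_def
proof (intro conjI ballI allI impI)
  fix i assume i: "i \<in> D"
  then obtain h where h: "h \<in> carrier R" "\<forall>I\<subseteq>D - {i}. c (insert i I) = c I \<oplus> h"
    using assms unfolding affine_cube_def by blast
  have "t \<otimes> (c (insert i I) \<ominus> s) = t \<otimes> (c I \<ominus> s) \<oplus> t \<otimes> h" if "I \<subseteq> D - {i}" for I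
  proof -
    have "c I \<in> carrier R" using assms(1) that unfolding affine_cube_def by blast
    then have "t \<otimes> (c I \<oplus> h \<ominus> s) = t \<otimes> (c I \<ominus> s) \<oplus> t \<otimes> h"
      using h(1) assms(2,3) by algebra
    then show ?thesis using h(2) that by simp
  qed
  moreover have "t \<otimes> h \<in> carrier R" using assms(3) h(1) by simp
  ultimately show "\<exists>h\<in>carrier R. \<forall>I\<subseteq>D - {i}. t \<otimes> (c (insert i I) \<ominus> s) = t \<otimes> (c I \<ominus> s) \<oplus> h"
    by blast
qed (use assms in \<open>auto simp: affine_cube_def\<close>)

lemma submodule_minus:
  assumes "submodule R U M" "x \<in> U" "y \<in> U"
  shows "x \<ominus>\<^bsub>M\<^esub> y \<in> U"
proof -
  have "y \<in> carrier M" using assms submodule.subset by blast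
  then have "\<ominus>\<^bsub>M\<^esub> y = (\<ominus> \<one>) \<odot>\<^bsub>M\<^esub> y" by (simp add: smult_minus_1)
  then show ?thesis
    unfolding a_minus_def using assms by (simp add: submodule.m_closed submodule.smult_closed)
qed

lemma deg_below_Suc:
  assumes U: "submodule R U M"
  shows "deg_below M U m D G \<Longrightarrow> deg_below M U (Suc m) D G"
proof (induction m arbitrary: D G)
  case 0
  show ?case
    unfolding deg_below.simps
  proof (intro ballI allI impI)
    fix i I assume "i \<in> D" "I \<subseteq> D - {i}"
    then have "I \<subseteq> D" "insert i I \<subseteq> D" by auto
    then show "G I \<ominus>\<^bsub>M\<^esub> G (insert i I) \<in> U" using 0 by (intro submodule_minus[OF U]) auto
  qed
next
  case (Suc m)
  have "deg_below M U (Suc m) (D - {i}) (\<lambda>I. G I \<ominus>\<^bsub>M\<^esub> G (insert i I))" if "i \<in> D" for i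
    by (rule Suc.IH) (use Suc.prems that in simp)
  then show ?case by (subst deg_below.simps) blast
qed

lemma deg_below_mono:
  assumes U: "submodule R U M" and "deg_below M U m D G" "m \<le> n"
  shows "deg_below M U n D G"
  using assms(3,2) by (induction rule: dec_induct) (auto intro: deg_below_Suc[OF U] simp del: deg_below.simps)

lemma deg_below_add:
  assumes U: "submodule R U M"
  shows "deg_below M U m D G \<Longrightarrow> deg_below M U m D H \<Longrightarrow>
    (\<And>I. I \<subseteq> D \<Longrightarrow> G I \<in> carrier M) \<Longrightarrow> (\<And>I. I \<subseteq> D \<Longrightarrow> H I \<in> carrier M) \<Longrightarrow>
    deg_below M U m D (\<lambda>I. G I \<oplus>\<^bsub>M\<^esub> H I)"
proof (induction m arbitrary: D G H)
  case 0
  then show ?case by (auto intro!: submodule.m_closed[OF U])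
next
  case (Suc m)
  show ?case
    unfolding deg_below.simps
  proof
    fix i assume i: "i \<in> D"
    have GH: "G I \<in> carrier M" "G (insert i I) \<in> carrier M"
      "H I \<in> carrier M" "H (insert i I) \<in> carrier M" if "I \<subseteq> D - {i}" for I
      using that i Suc.prems(3,4)[of I] Suc.prems(3,4)[of "insert i I"] by blast+
    have "deg_below M U m (D - {i})
      (\<lambda>I. (G I \<ominus>\<^bsub>M\<^esub> G (insert i I)) \<oplus>\<^bsub>M\<^esub> (H I \<ominus>\<^bsub>M\<^esub> H (insert i I)))"
      by (rule Suc.IH) (use Suc.prems(1,2) i GH in auto)
    moreover have "(G I \<ominus>\<^bsub>M\<^esub> G (insert i I)) \<oplus>\<^bsub>M\<^esub> (H I \<ominus>\<^bsub>M\<^esub> H (insert i I)) =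
        (G I \<oplus>\<^bsub>M\<^esub> H I) \<ominus>\<^bsub>M\<^esub> (G (insert i I) \<oplus>\<^bsub>M\<^esub> H (insert i I))" if "I \<subseteq> D - {i}" for I
      using GH[OF that] by (simp add: a_minus_def M.minus_add M.a_ac)
    ultimately show "deg_below M U m (D - {i})
        (\<lambda>I. (G I \<oplus>\<^bsub>M\<^esub> H I) \<ominus>\<^bsub>M\<^esub> (G (insert i I) \<oplus>\<^bsub>M\<^esub> H (insert i I)))"
      by (subst deg_below_cong[symmetric]) auto
  qed
qed

lemma deg_below_smult:
  assumes U: "submodule R U M" and s: "s \<in> carrier R"
  shows "deg_below M U m D G \<Longrightarrow> (\<And>I. I \<subseteq> D \<Longrightarrow> G I \<in> carrier M) \<Longrightarrow>
    deg_below M U m D (\<lambda>I. s \<odot>\<^bsub>M\<^esub> G I)"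
proof (induction m arbitrary: D G)
  case 0
  then show ?case using s by (auto intro!: submodule.smult_closed[OF U])
next
  case (Suc m)
  show ?case
    unfolding deg_below.simps
  proof
    fix i assume i: "i \<in> D"
    have G: "G I \<in> carrier M" "G (insert i I) \<in> carrier M" if "I \<subseteq> D - {i}" for I
      using that i Suc.prems(2)[of I] Suc.prems(2)[of "insert i I"] by blast+
    have "deg_below M U m (D - {i}) (\<lambda>I. s \<odot>\<^bsub>M\<^esub> (G I \<ominus>\<^bsub>M\<^esub> G (insert i I)))"
      by (rule Suc.IH) (use Suc.prems(1) i G in auto)
    moreover have "s \<odot>\<^bsub>M\<^esub> (G I \<ominus>\<^bsub>M\<^esub> G (insert i I)) =
        s \<odot>\<^bsub>M\<^esub> G I \<ominus>\<^bsub>M\<^esub> s \<odot>\<^bsub>M\<^esub> G (insert i I)" if "I \<subseteq> D - {i}" for I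
      using G[OF that] s by (simp add: a_minus_def smult_r_distr smult_r_minus)
    ultimately show "deg_below M U m (D - {i})
        (\<lambda>I. s \<odot>\<^bsub>M\<^esub> G I \<ominus>\<^bsub>M\<^esub> s \<odot>\<^bsub>M\<^esub> G (insert i I))"
      by (subst deg_below_cong[symmetric]) auto
  qed
qed

lemma deg_below_const:
  assumes "submodule R U M" "x \<in> carrier M"
  shows "deg_below M U (Suc 0) D (\<lambda>I. x)"
  using assms by (simp add: submodule.zero_closed a_minus_def M.r_neg)

text \<open>
  The Leibniz rule: with \<open>d\<close> the increment of \<open>c\<close> in direction \<open>i\<close>, and primes for the values
  at \<open>insert i I\<close>, one has \<open>c G - c' G' = (c + d) (G - G') - d G\<close>. The first term has an affine factor and
  a difference of \<open>G\<close>, so that induction applies.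
\<close>
lemma deg_below_affine_smult:
  assumes U: "submodule R U M"
  shows "deg_below M U m D G \<Longrightarrow> (\<And>I. I \<subseteq> D \<Longrightarrow> G I \<in> carrier M) \<Longrightarrow>
    affine_cube R D c \<Longrightarrow> deg_below M U (Suc m) D (\<lambda>I. c I \<odot>\<^bsub>M\<^esub> G I)"
proof (induction m arbitrary: D G c)
  case 0
  show ?case
    unfolding deg_below.simps
  proof (intro ballI allI impI)
    fix i I assume "i \<in> D" "I \<subseteq> D - {i}"
    then have "I \<subseteq> D" "insert i I \<subseteq> D" by auto
    then have "G I \<in> U" "G (insert i I) \<in> U" "c I \<in> carrier R" "c (insert i I) \<in> carrier R"
      using 0 by (auto simp: affine_cube_def)
    then show "c I \<odot>\<^bsub>M\<^esub> G I \<ominus>\<^bsub>M\<^esub> c (insert i I) \<odot>\<^bsub>M\<^esub> G (insert i I) \<in> U"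
      by (intro submodule_minus[OF U] submodule.smult_closed[OF U])
  qed
next
  case (Suc m)
  show ?case
    unfolding deg_below.simps(2)[of _ _ "Suc m"]
  proof
    fix i assume i: "i \<in> D"
    obtain d where d: "d \<in> carrier R" "\<And>I. I \<subseteq> D - {i} \<Longrightarrow> c (insert i I) = c I \<oplus> d"
      using Suc.prems(3) i unfolding affine_cube_def by blast
    have G: "G I \<in> carrier M" "G (insert i I) \<in> carrier M" "c I \<in> carrier R"
      if "I \<subseteq> D - {i}" for I
      using that i Suc.prems(2)[of I] Suc.prems(2)[of "insert i I"] Suc.prems(3)
      unfolding affine_cube_def by blast+
    have "affine_cube R (D - {i}) (\<lambda>I. \<one> \<otimes> (c I \<ominus> (\<ominus> d)))"
      using d(1) Suc.prems(3)
      by (intro affine_cube_normalize affine_cube_subset[of R D c "D - {i}"]) auto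
    then have c': "affine_cube R (D - {i}) (\<lambda>I. c I \<oplus> d)"
      by (rule affine_cube_cong[rotated]) (use G(3) d(1) in \<open>simp add: a_minus_def\<close>)
    have "deg_below M U (Suc m) (D - {i})
        (\<lambda>I. (c I \<oplus> d) \<odot>\<^bsub>M\<^esub> (G I \<ominus>\<^bsub>M\<^esub> G (insert i I)))"
      by (rule Suc.IH) (use Suc.prems(1) i G c' in auto)
    moreover have "deg_below M U (Suc m) (D - {i}) (\<lambda>I. (\<ominus> d) \<odot>\<^bsub>M\<^esub> G I)"
      by (rule deg_below_smult[OF U]) (use Suc.prems(1) d(1) G deg_below_subset[of M U "Suc m" D G "D - {i}"] in auto)
    ultimately have "deg_below M U (Suc m) (D - {i})
        (\<lambda>I. (c I \<oplus> d) \<odot>\<^bsub>M\<^esub> (G I \<ominus>\<^bsub>M\<^esub> G (insert i I)) \<oplus>\<^bsub>M\<^esub> (\<ominus> d) \<odot>\<^bsub>M\<^esub> G I)"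
      using G d(1) by (intro deg_below_add[OF U]) auto
    moreover have "(c I \<oplus> d) \<odot>\<^bsub>M\<^esub> (G I \<ominus>\<^bsub>M\<^esub> G (insert i I)) \<oplus>\<^bsub>M\<^esub> (\<ominus> d) \<odot>\<^bsub>M\<^esub> G I =
        c I \<odot>\<^bsub>M\<^esub> G I \<ominus>\<^bsub>M\<^esub> c (insert i I) \<odot>\<^bsub>M\<^esub> G (insert i I)" if "I \<subseteq> D - {i}" for I
    proof -
      note [simp] = G[OF that] d(1) d(2)[OF that]
      have "(c I \<oplus> d) \<odot>\<^bsub>M\<^esub> (G I \<ominus>\<^bsub>M\<^esub> G (insert i I)) =
          (c I \<odot>\<^bsub>M\<^esub> G I \<oplus>\<^bsub>M\<^esub> d \<odot>\<^bsub>M\<^esub> G I) \<ominus>\<^bsub>M\<^esub> (c I \<oplus> d) \<odot>\<^bsub>M\<^esub> G (insert i I)"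
        by (simp add: a_minus_def smult_r_distr smult_r_minus smult_l_distr)
      moreover have "(a \<oplus>\<^bsub>M\<^esub> b) \<ominus>\<^bsub>M\<^esub> e \<oplus>\<^bsub>M\<^esub> \<ominus>\<^bsub>M\<^esub> b = a \<ominus>\<^bsub>M\<^esub> e"
        if "a \<in> carrier M" "b \<in> carrier M" "e \<in> carrier M" for a b e
      proof -
        have "(a \<oplus>\<^bsub>M\<^esub> b) \<ominus>\<^bsub>M\<^esub> e \<oplus>\<^bsub>M\<^esub> \<ominus>\<^bsub>M\<^esub> b = (a \<ominus>\<^bsub>M\<^esub> e) \<oplus>\<^bsub>M\<^esub> (b \<oplus>\<^bsub>M\<^esub> \<ominus>\<^bsub>M\<^esub> b)"
          using that by (simp add: a_minus_def M.a_ac)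
        then show ?thesis using that by (simp add: M.r_neg)
      qed
      ultimately show ?thesis by (simp add: smult_l_minus)
    qed
    ultimately show "deg_below M U (Suc m) (D - {i})
        (\<lambda>I. c I \<odot>\<^bsub>M\<^esub> G I \<ominus>\<^bsub>M\<^esub> c (insert i I) \<odot>\<^bsub>M\<^esub> G (insert i I))"
      by (subst deg_below_cong[symmetric]) auto
  qed
qed

text \<open>
  Interpolation: if functions that become affine on the cube separate the points of \<open>E\<close>, then
  any function on \<open>E\<close> is a combination of products of at most \<open>card E - 1\<close> of them.
\<close>
lemma deg_below_finite_range:
  assumes U: "submodule R U M" and "finite E"
    and f: "\<And>I. I \<subseteq> D \<Longrightarrow> f I \<in> E" and a: "a \<in> E \<rightarrow> carrier M"
    and sep: "\<And>e e'. e \<in> E \<Longrightarrow> e' \<in> E \<Longrightarrow> e \<noteq> e' \<Longrightarrow>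
      \<exists>c\<in>E \<rightarrow> carrier R. c e = \<one> \<and> c e' = \<zero> \<and> affine_cube R D (\<lambda>I. c (f I))"
  shows "deg_below M U (card E) D (\<lambda>I. a (f I))"
proof -
  \<comment> \<open>the Lagrange factor at \<open>e\<close>: a product of one separating function for each point of \<open>A\<close>\<close>
  have bump: "\<exists>G\<in>E \<rightarrow> carrier M. deg_below M U (Suc (card A)) D (\<lambda>I. G (f I)) \<and>
      (\<forall>e'\<in>A. G e' = \<zero>\<^bsub>M\<^esub>) \<and> G e = x"
    if "finite A" "A \<subseteq> E" "e \<in> E - A" "x \<in> carrier M" for A e x
    using that
  proof (induction A rule: finite_induct)
    case empty
    then show ?case using deg_below_const[OF U, of x] by (intro bexI[of _ "\<lambda>_. x"]) (auto simp del: deg_below.simps)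
  next
    case (insert e' A)
    then obtain G where G: "G \<in> E \<rightarrow> carrier M" "deg_below M U (Suc (card A)) D (\<lambda>I. G (f I))"
      "\<forall>e'\<in>A. G e' = \<zero>\<^bsub>M\<^esub>" "G e = x" by auto
    obtain c where c: "c \<in> E \<rightarrow> carrier R" "c e = \<one>" "c e' = \<zero>"
      "affine_cube R D (\<lambda>I. c (f I))"
      using sep[of e e'] insert.prems by auto
    have "deg_below M U (Suc (Suc (card A))) D (\<lambda>I. c (f I) \<odot>\<^bsub>M\<^esub> G (f I))"
      using G(1,2) c(4) f by (intro deg_below_affine_smult[OF U]) auto
    then show ?case using G c insert
      by (intro bexI[of _ "\<lambda>e. c e \<odot>\<^bsub>M\<^esub> G e"]) (auto simp: Pi_iff simp del: deg_below.simps)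
  qed
  \<comment> \<open>Newton's scheme: correct the interpolating function at one new point at a time\<close>
  have "\<exists>G\<in>E \<rightarrow> carrier M. deg_below M U (card A) D (\<lambda>I. G (f I)) \<and> (\<forall>e\<in>A. G e = a e)"
    if "finite A" "A \<subseteq> E" for A
    using that
  proof (induction A rule: finite_induct)
    case empty
    show ?case using submodule.zero_closed[OF U] by (intro bexI[of _ "\<lambda>_. \<zero>\<^bsub>M\<^esub>"]) auto
  next
    case (insert e A)
    then obtain G where G: "G \<in> E \<rightarrow> carrier M" "deg_below M U (card A) D (\<lambda>I. G (f I))"
      "\<forall>e\<in>A. G e = a e" by auto
    have ea: "a e \<in> carrier M" "G e \<in> carrier M" using a G(1) insert.prems by auto
    obtain H where H: "H \<in> E \<rightarrow> carrier M" "deg_below M U (Suc (card A)) D (\<lambda>I. H (f I))"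
      "\<forall>e'\<in>A. H e' = \<zero>\<^bsub>M\<^esub>" "H e = a e \<ominus>\<^bsub>M\<^esub> G e"
      using bump[of A e "a e \<ominus>\<^bsub>M\<^esub> G e"] insert ea by auto
    have "deg_below M U (Suc (card A)) D (\<lambda>I. G (f I) \<oplus>\<^bsub>M\<^esub> H (f I))"
      using G(1) H(1,2) deg_below_Suc[OF U G(2)] f by (intro deg_below_add[OF U]) auto
    moreover have "G e \<oplus>\<^bsub>M\<^esub> H e = a e"
      using ea unfolding H(4) a_minus_def by (metis M.add.inv_closed M.a_comm M.r_neg1 M.minus_closed M.r_neg2 a_minus_def)
    moreover have "G e' \<oplus>\<^bsub>M\<^esub> H e' = a e'" if "e' \<in> A" for e'
      using that G(1,3) H(3) insert.prems by (metis M.r_zero Pi_mem insert_subset subset_iff)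
    ultimately show ?case using G(1) H(1) insert.hyps
      by (intro bexI[of _ "\<lambda>e. G e \<oplus>\<^bsub>M\<^esub> H e"]) (auto simp: Pi_iff simp del: deg_below.simps)
  qed
  from this[OF \<open>finite E\<close> order_refl] obtain G
    where "deg_below M U (card E) D (\<lambda>I. G (f I))" "\<forall>e\<in>E. G e = a e" by blast
  then show ?thesis using f by (subst deg_below_cong[of D _ "\<lambda>I. G (f I)"]) auto
qed

text \<open>
  If all other values of \<open>G\<close> vanish, each difference at the empty vertex is just the value of \<open>G\<close>
  there.
\<close>
lemma deg_below_concentrated:
  assumes U: "submodule R U M"
  shows "deg_below M U m D G \<Longrightarrow> finite D \<Longrightarrow> m \<le> card D \<Longrightarrow> G {} \<in> carrier M \<Longrightarrow>
    (\<And>I. I \<subseteq> D \<Longrightarrow> I \<noteq> {} \<Longrightarrow> G I \<in> U) \<Longrightarrow> G {} \<in> U"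
proof (induction m arbitrary: D G)
  case 0
  then show ?case by simp
next
  case (Suc m)
  then obtain i where i: "i \<in> D" by fastforce
  have Gi: "G {i} \<in> U" using Suc.prems(5) i by auto
  then have Gic: "G {i} \<in> carrier M" using submodule.subset[OF U] by blast
  have "G {} \<ominus>\<^bsub>M\<^esub> G (insert i {}) \<in> U"
  proof (rule Suc.IH[of "D - {i}"])
    show "G I \<ominus>\<^bsub>M\<^esub> G (insert i I) \<in> U" if "I \<subseteq> D - {i}" "I \<noteq> {}" for I
      using that i by (intro submodule_minus[OF U] Suc.prems(5)) auto
  qed (use Suc.prems i Gic in auto)
  then have "(G {} \<ominus>\<^bsub>M\<^esub> G {i}) \<oplus>\<^bsub>M\<^esub> G {i} \<in> U"
    using Gi submodule.m_closed[OF U] by simp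
  then show ?case using Suc.prems(4) Gic by (simp add: a_minus_def M.a_assoc M.l_neg)
qed

end


section \<open>Vector spaces over a finite field\<close>

text \<open>
  Two distinct vectors differ in some coordinate with respect to a basis.
\<close>
lemma (in vectorspace) additive_form_separating:
  assumes "fin_dim" "v \<in> carrier V" "w \<in> carrier V" "v \<noteq> w"
  shows "\<exists>l\<in>carrier V \<rightarrow> carrier K.
    (\<forall>x\<in>carrier V. \<forall>y\<in>carrier V. l (x \<oplus>\<^bsub>V\<^esub> y) = l x \<oplus>\<^bsub>K\<^esub> l y) \<and> l v \<noteq> l w"
proof -
  obtain B where B: "finite B" "basis B" using finite_basis_exists[OF assms(1)] by blast
  then have BV: "B \<subseteq> carrier V" by (simp add: basis_def)
  have uniq: "\<exists>!a. a \<in> B \<rightarrow>\<^sub>E carrier K \<and> lincomb a B = x" if "x \<in> carrier V" for x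
    using basis_criterion[OF B(1) BV] B(2) that by blast
  define a where "a x = (THE a. a \<in> B \<rightarrow>\<^sub>E carrier K \<and> lincomb a B = x)" for x
  have a: "a x \<in> B \<rightarrow>\<^sub>E carrier K" "lincomb (a x) B = x" if "x \<in> carrier V" for x
    using theI'[OF uniq[OF that]] unfolding a_def by blast+
  have aV: "a x \<in> B \<rightarrow> carrier K" if "x \<in> carrier V" for x
    using a(1)[OF that] by auto
  have add: "a (x \<oplus>\<^bsub>V\<^esub> y) b = a x b \<oplus>\<^bsub>K\<^esub> a y b"
    if "x \<in> carrier V" "y \<in> carrier V" "b \<in> B" for x y b
  proof -
    let ?s = "\<lambda>b\<in>B. a x b \<oplus>\<^bsub>K\<^esub> a y b"
    have "?s \<in> B \<rightarrow>\<^sub>E carrier K" using aV that by auto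
    moreover have "lincomb ?s B = lincomb (\<lambda>b. a x b \<oplus>\<^bsub>K\<^esub> a y b) B"
      using aV that BV by (intro lincomb_cong) auto
    then have "lincomb ?s B = x \<oplus>\<^bsub>V\<^esub> y"
      using lincomb_sum[OF B(1) BV aV aV] a(2) that by simp
    ultimately have "a (x \<oplus>\<^bsub>V\<^esub> y) = ?s"
      using uniq[of "x \<oplus>\<^bsub>V\<^esub> y"] a[of "x \<oplus>\<^bsub>V\<^esub> y"] that by auto
    then show ?thesis using that by simp
  qed
  have "a v \<noteq> a w" using a(2) assms(2-4) by metis
  then obtain b where "a v b \<noteq> a w b" by blast
  moreover have "b \<in> B"
    using calculation a(1)[OF assms(2)] a(1)[OF assms(3)] by (metis PiE_E)
  ultimately show ?thesis
    using add aV by (intro bexI[of _ "\<lambda>x. a x b"]) (auto simp: Pi_iff)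
qed

lemma (in vectorspace) fin_dim_iff_finite_carrier:
  assumes "finite (carrier K)"
  shows "fin_dim \<longleftrightarrow> finite (carrier V)"
proof
  assume "fin_dim"
  then obtain B where B: "finite B" "B \<subseteq> carrier V" "span B = carrier V"
    unfolding fin_dim_def by blast
  have "carrier V \<subseteq> (\<lambda>a. lincomb a B) ` (B \<rightarrow>\<^sub>E carrier K)"
  proof
    fix v assume "v \<in> carrier V"
    then obtain a where a: "a \<in> B \<rightarrow> carrier K" "lincomb a B = v"
      using finite_in_span[OF B(1,2)] B(3) by blast
    have "lincomb (restrict a B) B = lincomb a B"
      using a B by (intro lincomb_cong) auto
    with a show "v \<in> (\<lambda>a. lincomb a B) ` (B \<rightarrow>\<^sub>E carrier K)"
      by (intro image_eqI[of _ _ "restrict a B"]) auto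
  qed
  then show "finite (carrier V)"
    using finite_PiE[OF B(1), of "\<lambda>_. carrier K"] assms by (meson finite_imageI finite_subset)
next
  assume "finite (carrier V)"
  then show fin_dim
    unfolding fin_dim_def using in_own_span[of "carrier V"] span_is_subset2[of "carrier V"] by blast
qed

section \<open>Spaces with a distinguished subspace\<close>

lemma gr_obD:
  assumes "A \<in> gr_ob K"
  shows "vectorspace K (fst A)" "vectorspace.fin_dim K (fst A)" "submodule K (snd A) (fst A)"
    "snd A \<subseteq> carrier (fst A)"
  using assms by (auto simp: gr_ob_def subspace_def submodule_def)

lemma gr_homD:
  assumes "f \<in> gr_hom K A B"
  shows "f \<in> module_hom K (fst A) (fst B)" "f \<in> carrier (fst A) \<rightarrow> carrier (fst B)"
    "f \<in> extensional (carrier (fst A))" "f ` snd A = snd B"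
    "v \<in> carrier (fst A) \<Longrightarrow> f v \<in> carrier (fst B)"
    "v \<in> carrier (fst A) \<Longrightarrow> w \<in> carrier (fst A) \<Longrightarrow>
      f (v \<oplus>\<^bsub>fst A\<^esub> w) = f v \<oplus>\<^bsub>fst B\<^esub> f w"
    "c \<in> carrier K \<Longrightarrow> v \<in> carrier (fst A) \<Longrightarrow> f (c \<odot>\<^bsub>fst A\<^esub> v) = c \<odot>\<^bsub>fst B\<^esub> f v"
  using assms by (auto simp: gr_hom_def linear_maps_def module_hom_def)

lemma gr_homI:
  assumes "\<And>v. v \<in> carrier (fst A) \<Longrightarrow> f v \<in> carrier (fst B)"
    "\<And>v w. v \<in> carrier (fst A) \<Longrightarrow> w \<in> carrier (fst A) \<Longrightarrow>
      f (v \<oplus>\<^bsub>fst A\<^esub> w) = f v \<oplus>\<^bsub>fst B\<^esub> f w"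
    "\<And>c v. c \<in> carrier K \<Longrightarrow> v \<in> carrier (fst A) \<Longrightarrow>
      f (c \<odot>\<^bsub>fst A\<^esub> v) = c \<odot>\<^bsub>fst B\<^esub> f v"
    "f \<in> extensional (carrier (fst A))" "f ` snd A = snd B"
  shows "f \<in> gr_hom K A B"
  using assms by (auto simp: gr_hom_def linear_maps_def module_hom_def)

lemma gr_id_in_gr_hom: "A \<in> gr_ob K \<Longrightarrow> gr_id A \<in> gr_hom K A A"
proof (rule gr_homI)
  assume A: "A \<in> gr_ob K"
  interpret vectorspace K "fst A" using gr_obD[OF A] by simp
  show "gr_id A (v \<oplus>\<^bsub>fst A\<^esub> w) = gr_id A v \<oplus>\<^bsub>fst A\<^esub> gr_id A w"
    if "v \<in> carrier (fst A)" "w \<in> carrier (fst A)" for v w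
    using that by (simp add: gr_id_def)
  show "gr_id A (c \<odot>\<^bsub>fst A\<^esub> v) = c \<odot>\<^bsub>fst A\<^esub> gr_id A v"
    if "c \<in> carrier K" "v \<in> carrier (fst A)" for c v
    using that by (simp add: gr_id_def)
  show "gr_id A ` snd A = snd A"
    using gr_obD(4)[OF A] by (force simp: gr_id_def)
qed (auto simp: gr_id_def)

lemma gr_comp_in_gr_hom:
  assumes "A \<in> gr_ob K" "f \<in> gr_hom K A B" "g \<in> gr_hom K B C"
  shows "gr_comp A g f \<in> gr_hom K A C"
proof (rule gr_homI)
  interpret vectorspace K "fst A" using gr_obD[OF assms(1)] by simp
  note * = gr_homD[OF assms(2)] gr_homD[OF assms(3)]
  show "gr_comp A g f (v \<oplus>\<^bsub>fst A\<^esub> w) = gr_comp A g f v \<oplus>\<^bsub>fst C\<^esub> gr_comp A g f w"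
    if "v \<in> carrier (fst A)" "w \<in> carrier (fst A)" for v w
    using that * by (simp add: gr_comp_def compose_def)
  show "gr_comp A g f (c \<odot>\<^bsub>fst A\<^esub> v) = c \<odot>\<^bsub>fst C\<^esub> gr_comp A g f v"
    if "c \<in> carrier K" "v \<in> carrier (fst A)" for c v
    using that * by (simp add: gr_comp_def compose_def)
  have "gr_comp A g f ` snd A = g ` f ` snd A"
    using gr_obD(4)[OF assms(1)] by (force simp: gr_comp_def compose_def)
  then show "gr_comp A g f ` snd A = snd C" using * by simp
qed (use gr_homD[OF assms(2)] gr_homD[OF assms(3)] in \<open>auto simp: gr_comp_def compose_def\<close>)

lemma finite_gr_hom:
  assumes "finite (carrier K)" "A \<in> gr_ob K" "B \<in> gr_ob K"
  shows "finite (gr_hom K A B)"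
proof -
  have "finite (carrier (fst A))" "finite (carrier (fst B))"
    using gr_obD(1,2)[OF assms(2)] gr_obD(1,2)[OF assms(3)]
    by (simp_all add: vectorspace.fin_dim_iff_finite_carrier[OF _ assms(1)])
  then have "finite (carrier (fst A) \<rightarrow>\<^sub>E carrier (fst B))" by (simp add: finite_PiE)
  moreover have "gr_hom K A B \<subseteq> carrier (fst A) \<rightarrow>\<^sub>E carrier (fst B)"
  proof
    fix f assume "f \<in> gr_hom K A B"
    from gr_homD(2,3)[OF this] show "f \<in> carrier (fst A) \<rightarrow>\<^sub>E carrier (fst B)"
      by (simp add: PiE_def)
  qed
  ultimately show ?thesis by (rule finite_subset[rotated])
qed


section \<open>Adjoining coordinates\<close>

lemma adjoin_space_simps [simp]:
  "carrier (adjoin_space K V) = {Adjoin v a | v a. v \<in> carrier V \<and> a \<in> carrier K}"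
  "\<zero>\<^bsub>adjoin_space K V\<^esub> = Adjoin \<zero>\<^bsub>V\<^esub> \<zero>\<^bsub>K\<^esub>"
  "Adjoin v a \<oplus>\<^bsub>adjoin_space K V\<^esub> Adjoin w b = Adjoin (v \<oplus>\<^bsub>V\<^esub> w) (a \<oplus>\<^bsub>K\<^esub> b)"
  "c \<odot>\<^bsub>adjoin_space K V\<^esub> Adjoin v a = Adjoin (c \<odot>\<^bsub>V\<^esub> v) (c \<otimes>\<^bsub>K\<^esub> a)"
  by (simp_all add: adjoin_space_def)

lemma adjoin_ob_simps [simp]:
  "fst (adjoin_ob K A) = adjoin_space K (fst A)"
  "snd (adjoin_ob K A) = (\<lambda>w. Adjoin w \<zero>\<^bsub>K\<^esub>) ` snd A"
  by (simp_all add: adjoin_ob_def)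

lemma adjoin_space_vectorspace:
  assumes "vectorspace K V"
  shows "vectorspace K (adjoin_space K V)"
proof -
  interpret vectorspace K V by fact
  show ?thesis
  proof (rule vs_criteria)
    show "\<forall>v\<in>carrier (adjoin_space K V). \<exists>w\<in>carrier (adjoin_space K V).
        v \<oplus>\<^bsub>adjoin_space K V\<^esub> w = \<zero>\<^bsub>adjoin_space K V\<^esub>"
    proof
      fix v assume "v \<in> carrier (adjoin_space K V)"
      then obtain x a where "v = Adjoin x a" "x \<in> carrier V" "a \<in> carrier K" by auto
      then show "\<exists>w\<in>carrier (adjoin_space K V).
          v \<oplus>\<^bsub>adjoin_space K V\<^esub> w = \<zero>\<^bsub>adjoin_space K V\<^esub>"
        by (intro bexI[of _ "Adjoin (\<ominus>\<^bsub>V\<^esub> x) (\<ominus>\<^bsub>K\<^esub> a)"]) (auto simp: M.r_neg R.r_neg)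
    qed
    show "field K" by (rule field_axioms)
  qed (auto simp: M.a_ac R.a_ac smult_l_distr smult_r_distr smult_assoc1 l_distr r_distr m_assoc)
qed

lemma adjoin_ob_in_gr_ob:
  assumes finite_field: "finite (carrier K)" and "A \<in> gr_ob K"
  shows "adjoin_ob K A \<in> gr_ob K"
proof -
  interpret vectorspace K "fst A" using gr_obD[OF assms(2)] by simp
  interpret ad: vectorspace K "adjoin_space K (fst A)"
    by (rule adjoin_space_vectorspace) (rule vectorspace_axioms)
  have "finite (carrier (fst A))"
    using gr_obD(2)[OF assms(2)] fin_dim_iff_finite_carrier[OF finite_field] by simp
  then have "finite ((\<lambda>(v, a). Adjoin v a) ` (carrier (fst A) \<times> carrier K))"
    using finite_field by simp
  moreover have "carrier (adjoin_space K (fst A)) =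
      (\<lambda>(v, a). Adjoin v a) ` (carrier (fst A) \<times> carrier K)" by auto
  ultimately have "ad.fin_dim"
    by (simp only: ad.fin_dim_iff_finite_carrier[OF finite_field])
  moreover have "submodule K ((\<lambda>w. Adjoin w \<zero>\<^bsub>K\<^esub>) ` snd A) (adjoin_space K (fst A))"
  proof
    note sub = gr_obD(3)[OF assms(2)]
    show "(\<lambda>w. Adjoin w \<zero>\<^bsub>K\<^esub>) ` snd A \<subseteq> carrier (adjoin_space K (fst A))"
      using gr_obD(4)[OF assms(2)] by auto
    show "v \<oplus>\<^bsub>adjoin_space K (fst A)\<^esub> w \<in> (\<lambda>w. Adjoin w \<zero>\<^bsub>K\<^esub>) ` snd A"
      if "v \<in> (\<lambda>w. Adjoin w \<zero>\<^bsub>K\<^esub>) ` snd A" "w \<in> (\<lambda>w. Adjoin w \<zero>\<^bsub>K\<^esub>) ` snd A" for v w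
      using that submodule.m_closed[OF sub] by auto
    show "\<zero>\<^bsub>adjoin_space K (fst A)\<^esub> \<in> (\<lambda>w. Adjoin w \<zero>\<^bsub>K\<^esub>) ` snd A"
      using submodule.zero_closed[OF sub] by auto
    show "c \<odot>\<^bsub>adjoin_space K (fst A)\<^esub> v \<in> (\<lambda>w. Adjoin w \<zero>\<^bsub>K\<^esub>) ` snd A"
      if "c \<in> carrier K" "v \<in> (\<lambda>w. Adjoin w \<zero>\<^bsub>K\<^esub>) ` snd A" for c v
      using that submodule.smult_closed[OF sub] by auto
  qed
  ultimately show ?thesis
    using ad.vectorspace_axioms by (auto simp: gr_ob_def adjoin_ob_def subspace_def)
qed

lemma adjoin_ob_iter_in_gr_ob:
  "finite (carrier K) \<Longrightarrow> A \<in> gr_ob K \<Longrightarrow> (adjoin_ob K ^^ n) A \<in> gr_ob K"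
  by (induction n) (auto intro: adjoin_ob_in_gr_ob)

text \<open>
  The two values of \<open>kill\<close> give \<open>f \<oplus> id\<close> and \<open>f \<oplus> 0\<close>. Both send \<open>W \<oplus> 0\<close> onto the distinguished
  subspace of the target, as soon as \<open>f\<close> does so with \<open>W\<close>.
\<close>
lemma adjoin_mor_masked_in_gr_hom:
  assumes "A \<in> gr_ob K" "B \<in> gr_ob K" "f \<in> gr_hom K A B"
  shows "(\<lambda>x\<in>carrier (fst (adjoin_ob K A)).
      Adjoin (f (vec_part x)) (if kill then \<zero>\<^bsub>K\<^esub> else scal_part x))
    \<in> gr_hom K (adjoin_ob K A) (adjoin_ob K B)" (is "?g \<in> _")
proof (rule gr_homI)
  interpret A: vectorspace K "fst A" using gr_obD[OF assms(1)] by simp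
  note f = gr_homD[OF assms(3)]
  show "?g v \<in> carrier (fst (adjoin_ob K B))" if "v \<in> carrier (fst (adjoin_ob K A))" for v
    using that f(5-7) by auto
  show "?g (v \<oplus>\<^bsub>fst (adjoin_ob K A)\<^esub> w) = ?g v \<oplus>\<^bsub>fst (adjoin_ob K B)\<^esub> ?g w"
    if v: "v \<in> carrier (fst (adjoin_ob K A))" and w: "w \<in> carrier (fst (adjoin_ob K A))" for v w
  proof -
    obtain x a where "v = Adjoin x a" "x \<in> carrier (fst A)" "a \<in> carrier K"
      using v by auto
    moreover obtain y b where "w = Adjoin y b" "y \<in> carrier (fst A)" "b \<in> carrier K"
      using w by auto
    ultimately show ?thesis by (simp add: f(5,6))
  qed
  show "?g (c \<odot>\<^bsub>fst (adjoin_ob K A)\<^esub> v) = c \<odot>\<^bsub>fst (adjoin_ob K B)\<^esub> ?g v"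
    if c: "c \<in> carrier K" and v: "v \<in> carrier (fst (adjoin_ob K A))" for c v
  proof -
    obtain x a where "v = Adjoin x a" "x \<in> carrier (fst A)" "a \<in> carrier K" using v by auto
    then show ?thesis using c by (simp add: f(5,7))
  qed
  have "?g (Adjoin w \<zero>\<^bsub>K\<^esub>) = Adjoin (f w) \<zero>\<^bsub>K\<^esub>" if "w \<in> snd A" for w
    using that gr_obD(4)[OF assms(1)] by auto
  then have "?g ` snd (adjoin_ob K A) = (\<lambda>w. Adjoin w \<zero>\<^bsub>K\<^esub>) ` f ` snd A"
    unfolding adjoin_ob_simps image_image by (intro image_cong refl)
  then show "?g ` snd (adjoin_ob K A) = snd (adjoin_ob K B)" using f(4) by simp
qed auto

lemma adjoin_mor_in_gr_hom:
  assumes "A \<in> gr_ob K" "B \<in> gr_ob K" "f \<in> gr_hom K A B"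
  shows "adjoin_mor K A f \<in> gr_hom K (adjoin_ob K A) (adjoin_ob K B)"
  using adjoin_mor_masked_in_gr_hom[OF assms, of False] by (simp add: adjoin_mor_def)

definition adjoin_incl ::
  "('k, 'r) ring_scheme \<Rightarrow> ('k, ('u, 'k) vec_univ) gr_pair \<Rightarrow> ('u, 'k) vec_univ \<Rightarrow> ('u, 'k) vec_univ"
  where "adjoin_incl K A = (\<lambda>v\<in>carrier (fst A). Adjoin v \<zero>\<^bsub>K\<^esub>)"

lemma adjoin_incl_in_gr_hom:
  assumes "A \<in> gr_ob K"
  shows "adjoin_incl K A \<in> gr_hom K A (adjoin_ob K A)"
proof (rule gr_homI)
  interpret A: vectorspace K "fst A" using gr_obD[OF assms(1)] by simp
  have "adjoin_incl K A w = Adjoin w \<zero>\<^bsub>K\<^esub>" if "w \<in> snd A" for w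
    using that gr_obD(4)[OF assms(1)] by (auto simp: adjoin_incl_def)
  then show "adjoin_incl K A ` snd A = snd (adjoin_ob K A)"
    by (simp cong: image_cong)
  show "adjoin_incl K A v \<in> carrier (fst (adjoin_ob K A))" if "v \<in> carrier (fst A)" for v
    using that by (simp add: adjoin_incl_def)
  show "adjoin_incl K A (v \<oplus>\<^bsub>fst A\<^esub> w) =
      adjoin_incl K A v \<oplus>\<^bsub>fst (adjoin_ob K A)\<^esub> adjoin_incl K A w"
    if "v \<in> carrier (fst A)" "w \<in> carrier (fst A)" for v w
    using that by (simp add: adjoin_incl_def)
  show "adjoin_incl K A (c \<odot>\<^bsub>fst A\<^esub> v) = c \<odot>\<^bsub>fst (adjoin_ob K A)\<^esub> adjoin_incl K A v"
    if "c \<in> carrier K" "v \<in> carrier (fst A)" for c v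
    using that by (simp add: adjoin_incl_def)
qed (auto simp: adjoin_incl_def)

lemma adjoin_proj_in_gr_hom:
  assumes "A \<in> gr_ob K"
  shows "adjoin_proj K A \<in> gr_hom K (adjoin_ob K A) A"
proof (rule gr_homI)
  interpret A: vectorspace K "fst A" using gr_obD[OF assms(1)] by simp
  have "adjoin_proj K A (Adjoin w \<zero>\<^bsub>K\<^esub>) = w" if "w \<in> snd A" for w
    using that gr_obD(4)[OF assms(1)] by (auto simp: adjoin_proj_def)
  then show "adjoin_proj K A ` snd (adjoin_ob K A) = snd A"
    by (simp add: image_image cong: image_cong)
  show "adjoin_proj K A (v \<oplus>\<^bsub>fst (adjoin_ob K A)\<^esub> w) =
      adjoin_proj K A v \<oplus>\<^bsub>fst A\<^esub> adjoin_proj K A w"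
    if v: "v \<in> carrier (fst (adjoin_ob K A))" and w: "w \<in> carrier (fst (adjoin_ob K A))" for v w
  proof -
    obtain x a where "v = Adjoin x a" "x \<in> carrier (fst A)" "a \<in> carrier K"
      using v by auto
    moreover obtain y b where "w = Adjoin y b" "y \<in> carrier (fst A)" "b \<in> carrier K"
      using w by auto
    ultimately show ?thesis by (simp add: adjoin_proj_def)
  qed
  show "adjoin_proj K A (c \<odot>\<^bsub>fst (adjoin_ob K A)\<^esub> v) = c \<odot>\<^bsub>fst A\<^esub> adjoin_proj K A v"
    if c: "c \<in> carrier K" and v: "v \<in> carrier (fst (adjoin_ob K A))" for c v
  proof -
    obtain x a where "v = Adjoin x a" "x \<in> carrier (fst A)" "a \<in> carrier K" using v by auto
    then show ?thesis using c by (simp add: adjoin_proj_def)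
  qed
qed (auto simp: adjoin_proj_def)


section \<open>Setting adjoined coordinates to zero\<close>

lemma affine_cube_const:
  assumes "abelian_monoid N" "v \<in> carrier N"
  shows "affine_cube N D (\<lambda>I. v)"
  using assms unfolding affine_cube_def
  by (auto intro!: bexI[of _ "\<zero>\<^bsub>N\<^esub>"] simp: abelian_monoid.r_zero abelian_monoid.zero_closed)

lemma affine_cube_drop_coordinate:
  assumes "abelian_group N" "a \<in> carrier N"
  shows "affine_cube N D (\<lambda>I. if n \<in> I then \<zero>\<^bsub>N\<^esub> else a)"
proof -
  interpret abelian_group N by fact
  show ?thesis
    unfolding affine_cube_def
  proof (intro conjI ballI allI impI)
    fix i assume "i \<in> D"
    show "\<exists>h\<in>carrier N. \<forall>I\<subseteq>D - {i}. (if n \<in> insert i I then \<zero>\<^bsub>N\<^esub> else a) =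
        (if n \<in> I then \<zero>\<^bsub>N\<^esub> else a) \<oplus>\<^bsub>N\<^esub> h"
      using assms(2)
      by (intro bexI[of _ "if i = n then \<ominus>\<^bsub>N\<^esub> a else \<zero>\<^bsub>N\<^esub>"]) (auto simp: r_neg)
  qed (use assms(2) in auto)
qed

lemma affine_cube_adjoin:
  assumes "affine_cube V D g" "affine_cube K D c"
  shows "affine_cube (adjoin_space K V) D (\<lambda>I. Adjoin (g I) (c I))"
  unfolding affine_cube_def
proof (intro conjI ballI allI impI)
  fix i assume i: "i \<in> D"
  then obtain h where "h \<in> carrier V" "\<forall>I\<subseteq>D - {i}. g (insert i I) = g I \<oplus>\<^bsub>V\<^esub> h"
    using assms(1) unfolding affine_cube_def by blast
  moreover obtain b where "b \<in> carrier K" "\<forall>I\<subseteq>D - {i}. c (insert i I) = c I \<oplus>\<^bsub>K\<^esub> b"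
    using assms(2) i unfolding affine_cube_def by blast
  ultimately show "\<exists>h\<in>carrier (adjoin_space K V). \<forall>I\<subseteq>D - {i}.
      Adjoin (g (insert i I)) (c (insert i I)) =
      Adjoin (g I) (c I) \<oplus>\<^bsub>adjoin_space K V\<^esub> h"
    by (intro bexI[of _ "Adjoin h b"]) auto
qed (use assms in \<open>auto simp: affine_cube_def\<close>)

text \<open>
  The idempotent of \<open>V \<oplus> K\<^sup>n\<close> that sets the adjoined coordinates with index in \<open>I\<close> to zero. Index
  \<open>0\<close> belongs to the coordinate adjoined first, which is the innermost one.
\<close>
primrec mask ::
  "('k, 'r) ring_scheme \<Rightarrow> ('k, ('u, 'k) vec_univ) gr_pair \<Rightarrow> nat \<Rightarrow> nat set \<Rightarrow>
    ('u, 'k) vec_univ \<Rightarrow> ('u, 'k) vec_univ"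
  where
    "mask K A 0 I = gr_id A"
  | "mask K A (Suc n) I = (\<lambda>x\<in>carrier (fst (adjoin_ob K ((adjoin_ob K ^^ n) A))).
      Adjoin (mask K A n I (vec_part x)) (if n \<in> I then \<zero>\<^bsub>K\<^esub> else scal_part x))"

text \<open>
  The map \<open>f \<oplus> id\<close> on \<open>V \<oplus> K\<^sup>n\<close>.
\<close>
primrec adjoin_mor_iter ::
  "('k, 'r) ring_scheme \<Rightarrow> nat \<Rightarrow> ('k, ('u, 'k) vec_univ) gr_pair \<Rightarrow>
    (('u, 'k) vec_univ \<Rightarrow> ('u, 'k) vec_univ) \<Rightarrow> ('u, 'k) vec_univ \<Rightarrow> ('u, 'k) vec_univ"
  where
    "adjoin_mor_iter K 0 A f = f"
  | "adjoin_mor_iter K (Suc n) A f = adjoin_mor K ((adjoin_ob K ^^ n) A) (adjoin_mor_iter K n A f)"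

lemma adjoin_mor_iter_in_gr_hom:
  assumes finite_field: "finite (carrier K)" and A: "A \<in> gr_ob K" "B \<in> gr_ob K" "f \<in> gr_hom K A B"
  shows "adjoin_mor_iter K n A f \<in> gr_hom K ((adjoin_ob K ^^ n) A) ((adjoin_ob K ^^ n) B)"
  by (induction n)
    (use assms in \<open>auto intro!: adjoin_mor_in_gr_hom adjoin_ob_iter_in_gr_ob\<close>)

lemma adjoin_mor_iter_Suc:
  "adjoin_mor_iter K n (adjoin_ob K A) (adjoin_mor K A f) = adjoin_mor_iter K (Suc n) A f"
  by (induction n) (simp_all add: funpow_swap1)

lemma mask_in_gr_hom:
  assumes finite_field: "finite (carrier K)" and A: "A \<in> gr_ob K"
  shows "mask K A n I \<in> gr_hom K ((adjoin_ob K ^^ n) A) ((adjoin_ob K ^^ n) A)"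
proof (induction n)
  case 0
  show ?case using gr_id_in_gr_hom[OF A] by simp
next
  case (Suc n)
  then show ?case
    using adjoin_mor_masked_in_gr_hom[OF _ _ Suc, of "n \<in> I"]
      adjoin_ob_iter_in_gr_ob[OF finite_field A] by (simp only: mask.simps funpow.simps o_apply)
qed

lemma mask_empty:
  "x \<in> carrier (fst ((adjoin_ob K ^^ n) A)) \<Longrightarrow> mask K A n {} x = x"
  by (induction n arbitrary: x) (auto simp: gr_id_def)

lemma mask_mask:
  assumes finite_field: "finite (carrier K)" and A: "A \<in> gr_ob K" and x: "x \<in> carrier (fst ((adjoin_ob K ^^ n) A))"
  shows "mask K A n I (mask K A n J x) = mask K A n (I \<union> J) x"
  using assms(3)
proof (induction n arbitrary: x)
  case 0
  then show ?case by (simp add: gr_id_def)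
next
  case (Suc n)
  obtain v a where x: "x = Adjoin v a" "v \<in> carrier (fst ((adjoin_ob K ^^ n) A))" "a \<in> carrier K"
    using Suc.prems by auto
  have "mask K A n J v \<in> carrier (fst ((adjoin_ob K ^^ n) A))"
    using gr_homD(5)[OF mask_in_gr_hom[OF finite_field A] x(2)] .
  moreover have "\<zero>\<^bsub>K\<^esub> \<in> carrier K"
    using gr_obD(1)[OF A] by (simp add: vectorspace_def field_def domain_def cring_def ring.ring_simprules)
  ultimately show ?case using Suc.IH x by auto
qed

text \<open>
  Adding \<open>i\<close> to \<open>I\<close> subtracts the \<open>i\<close>-th coordinate of \<open>x\<close>, whatever the other masked
  coordinates are.
\<close>
lemma affine_cube_mask:
  assumes A: "A \<in> gr_ob K" and x: "x \<in> carrier (fst ((adjoin_ob K ^^ n) A))"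
  shows "affine_cube (fst ((adjoin_ob K ^^ n) A)) D (\<lambda>I. mask K A n I x)"
  using assms(2)
proof (induction n arbitrary: x)
  case 0
  interpret vectorspace K "fst A" using gr_obD(1)[OF A] .
  show ?case using 0 affine_cube_const[of "fst A" x] M.abelian_monoid_axioms
    by (simp add: gr_id_def)
next
  case (Suc n)
  interpret vectorspace K "fst A" using gr_obD(1)[OF A] .
  obtain v a where x: "x = Adjoin v a" "v \<in> carrier (fst ((adjoin_ob K ^^ n) A))" "a \<in> carrier K"
    using Suc.prems by auto
  have "affine_cube (adjoin_space K (fst ((adjoin_ob K ^^ n) A))) D
      (\<lambda>I. Adjoin (mask K A n I v) (if n \<in> I then \<zero>\<^bsub>K\<^esub> else a))"
    using Suc.IH[OF x(2)] affine_cube_drop_coordinate[OF R.abelian_group_axioms x(3)]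
    by (rule affine_cube_adjoin)
  then show ?case using x by (simp cong: if_cong)
qed

text \<open>
  The adjoined coordinates of \<open>(V \<oplus> K) \<oplus> K\<^sup>n\<close> are those of \<open>V \<oplus> K\<^bsup>n+1\<^esup>\<close> without the first.
  Together with \<open>mask_first\<close> this allows to treat the coordinates one at a time, in the order in
  which the difference functor is iterated.
\<close>
lemma mask_shift:
  "mask K (adjoin_ob K A) n {j} = mask K A (Suc n) {Suc j}"
proof (induction n)
  case 0
  show ?case by (rule ext) (auto simp: gr_id_def restrict_def)
next
  case (Suc n)
  have "(adjoin_ob K ^^ n) (adjoin_ob K A) = (adjoin_ob K ^^ Suc n) A" by (simp add: funpow_swap1)
  then show ?case
    unfolding mask.simps(2)[of K "adjoin_ob K A" n] mask.simps(2)[of K A "Suc n"] Suc.IH by simp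
qed

text \<open>
  Setting a coordinate to zero factors through forgetting it, and so kills the kernel that
  defines the difference functor.
\<close>
lemma mask_first:
  assumes finite_field: "finite (carrier K)" and A: "A \<in> gr_ob K"
  shows "mask K A (Suc n) {0} = gr_comp ((adjoin_ob K ^^ Suc n) A)
    (adjoin_mor_iter K n A (adjoin_incl K A)) (adjoin_mor_iter K n (adjoin_ob K A) (adjoin_proj K A))"
proof (induction n)
  case 0
  show ?case
    by (rule ext) (auto simp: gr_comp_def compose_def gr_id_def adjoin_incl_def adjoin_proj_def restrict_def)
next
  case (Suc n)
  have sw: "(adjoin_ob K ^^ n) (adjoin_ob K A) = adjoin_ob K ((adjoin_ob K ^^ n) A)"
    by (simp add: funpow_swap1)
  have pr: "adjoin_mor_iter K n (adjoin_ob K A) (adjoin_proj K A) \<in>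
      gr_hom K (adjoin_ob K ((adjoin_ob K ^^ n) A)) ((adjoin_ob K ^^ n) A)"
    using adjoin_mor_iter_in_gr_hom[OF finite_field adjoin_ob_in_gr_ob[OF finite_field A] A
      adjoin_proj_in_gr_hom[OF A], of n] by (simp add: sw)
  show ?case
  proof (rule ext)
    fix x
    show "mask K A (Suc (Suc n)) {0} x = gr_comp ((adjoin_ob K ^^ Suc (Suc n)) A)
        (adjoin_mor_iter K (Suc n) A (adjoin_incl K A))
        (adjoin_mor_iter K (Suc n) (adjoin_ob K A) (adjoin_proj K A)) x"
    proof (cases "x \<in> carrier (fst ((adjoin_ob K ^^ Suc (Suc n)) A))")
      case True
      then obtain v a where x: "x = Adjoin v a" "a \<in> carrier K"
        "v \<in> carrier (fst ((adjoin_ob K ^^ Suc n) A))" by auto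
      have "adjoin_mor_iter K n (adjoin_ob K A) (adjoin_proj K A) v \<in> carrier (fst ((adjoin_ob K ^^ n) A))"
        using gr_homD(5)[OF pr] x(3) by simp
      moreover have "mask K A (Suc n) {0} v = adjoin_mor_iter K n A (adjoin_incl K A)
          (adjoin_mor_iter K n (adjoin_ob K A) (adjoin_proj K A) v)"
        unfolding Suc.IH using x(3) by (simp add: gr_comp_def compose_def)
      ultimately show ?thesis
        using x True
        by (simp add: mask.simps(2)[of K A "Suc n"] gr_comp_def compose_def adjoin_mor_def sw del: mask.simps)
    next
      case False
      then show ?thesis
        by (simp only: mask.simps(2)[of K A "Suc n"] gr_comp_def compose_def restrict_def funpow.simps o_apply if_False)
    qed
  qed
qed


section \<open>Functors on spaces with a distinguished subspace\<close>

context gr_functor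
begin

lemma mor_closed:
  assumes "A \<in> gr_ob K" "B \<in> gr_ob K" "f \<in> gr_hom K A B" "x \<in> carrier (ob X A)"
  shows "mor X A B f x \<in> carrier (ob X B)"
  using mor_linear[OF assms(1-3)] assms(4) by (auto simp: linear_maps_def module_hom_def)

lemma mod_hom_mor:
  assumes "A \<in> gr_ob K" "B \<in> gr_ob K" "f \<in> gr_hom K A B"
  shows "mod_hom K (ob X A) (ob X B) (mor X A B f)"
  using mor_linear[OF assms] ob_vectorspace[OF assms(1)] ob_vectorspace[OF assms(2)]
  by (auto simp: mod_hom_def mod_hom_axioms_def linear_maps_def vectorspace_def)

lemma mor_comp_apply:
  assumes "A \<in> gr_ob K" "B \<in> gr_ob K" "C \<in> gr_ob K" "f \<in> gr_hom K A B" "g \<in> gr_hom K B C"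
    "x \<in> carrier (ob X A)"
  shows "mor X A C (gr_comp A g f) x = mor X B C g (mor X A B f x)"
  using mor_comp[OF assms(1-5)] assms(6) by (simp add: compose_def)

end

lemma subfunctorD:
  assumes "subfunctor K X Y" "A \<in> gr_ob K"
  shows "submodule K (Y A) (ob X A)" "Y A \<subseteq> carrier (ob X A)"
    "B \<in> gr_ob K \<Longrightarrow> f \<in> gr_hom K A B \<Longrightarrow> x \<in> Y A \<Longrightarrow> mor X A B f x \<in> Y B"
proof -
  show "submodule K (Y A) (ob X A)"
    using assms by (simp add: subfunctor_def subspace_def)
  then show "Y A \<subseteq> carrier (ob X A)" by (rule submodule.subset)
  show "mor X A B f x \<in> Y B" if "B \<in> gr_ob K" "f \<in> gr_hom K A B" "x \<in> Y A"
    using assms that unfolding subfunctor_def by blast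
qed

section \<open>Quotient spaces and simple subquotients\<close>

context module
begin

lemma submodule_abelian_subgroup:
  assumes "submodule R U M"
  shows "abelian_subgroup U M"
proof (rule abelian_subgroupI3)
  have "\<ominus>\<^bsub>M\<^esub> x \<in> U" if "x \<in> U" for x
    using submodule_minus[OF assms submodule.zero_closed[OF assms] that] that
      submodule.subset[OF assms] by (auto simp: a_minus_def)
  then show "additive_subgroup U M"
    using assms unfolding additive_subgroup_def
    by unfold_locales (auto simp: submodule_def a_inv_def)
qed unfold_locales

lemma mem_submodule_cosetD:
  assumes "submodule R U M" "x \<in> carrier M" "z \<in> U +>\<^bsub>M\<^esub> x"
  shows "z \<in> carrier M" "U +>\<^bsub>M\<^esub> z = U +>\<^bsub>M\<^esub> x"
proof -
  interpret U: abelian_subgroup U M by (rule submodule_abelian_subgroup) fact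
  show "z \<in> carrier M"
    using assms submodule.subset[OF assms(1)] by (auto simp: a_r_coset_def')
  show "U +>\<^bsub>M\<^esub> z = U +>\<^bsub>M\<^esub> x"
    using M.a_repr_independence[OF assms(3,2) U.a_subgroup] by simp
qed

lemma submodule_coset_eq_iff:
  assumes "submodule R U M" "x \<in> carrier M" "y \<in> carrier M"
  shows "U +>\<^bsub>M\<^esub> x = U +>\<^bsub>M\<^esub> y \<longleftrightarrow> x \<ominus>\<^bsub>M\<^esub> y \<in> U"
proof -
  interpret U: abelian_subgroup U M by (rule submodule_abelian_subgroup) fact
  have "U +>\<^bsub>M\<^esub> x = U +>\<^bsub>M\<^esub> y \<longleftrightarrow> x \<in> U +>\<^bsub>M\<^esub> y"
    using mem_submodule_cosetD(2)[OF assms(1,3)] U.a_rcos_self[OF assms(2)] by auto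
  also have "\<dots> \<longleftrightarrow> x \<ominus>\<^bsub>M\<^esub> y \<in> U"
  proof
    assume "x \<in> U +>\<^bsub>M\<^esub> y"
    then obtain u where "u \<in> U" "x = u \<oplus>\<^bsub>M\<^esub> y" by (auto simp: a_r_coset_def')
    then show "x \<ominus>\<^bsub>M\<^esub> y \<in> U"
      using assms(3) submodule.subset[OF assms(1)] by (auto simp: a_minus_def M.a_assoc M.r_neg)
  next
    assume "x \<ominus>\<^bsub>M\<^esub> y \<in> U"
    moreover have "x = (x \<ominus>\<^bsub>M\<^esub> y) \<oplus>\<^bsub>M\<^esub> y"
      using assms(2,3) by (simp add: a_minus_def M.a_assoc M.l_neg)
    ultimately show "x \<in> U +>\<^bsub>M\<^esub> y" unfolding a_r_coset_def' by blast
  qed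
  finally show ?thesis .
qed

lemma coset_smult:
  assumes "submodule R U M" "x \<in> carrier M" "c \<in> carrier R"
  shows "(\<Union>z\<in>U +>\<^bsub>M\<^esub> x. U +>\<^bsub>M\<^esub> (c \<odot>\<^bsub>M\<^esub> z)) = U +>\<^bsub>M\<^esub> (c \<odot>\<^bsub>M\<^esub> x)"
proof -
  interpret U: abelian_subgroup U M by (rule submodule_abelian_subgroup) fact
  have "U +>\<^bsub>M\<^esub> (c \<odot>\<^bsub>M\<^esub> z) = U +>\<^bsub>M\<^esub> (c \<odot>\<^bsub>M\<^esub> x)" if "z \<in> U +>\<^bsub>M\<^esub> x" for z
  proof -
    note z = mem_submodule_cosetD[OF assms(1,2) that]
    then have "z \<ominus>\<^bsub>M\<^esub> x \<in> U" using submodule_coset_eq_iff assms by metis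
    then have "c \<odot>\<^bsub>M\<^esub> (z \<ominus>\<^bsub>M\<^esub> x) \<in> U" using submodule.smult_closed assms by metis
    then have "c \<odot>\<^bsub>M\<^esub> z \<ominus>\<^bsub>M\<^esub> c \<odot>\<^bsub>M\<^esub> x \<in> U"
      using z assms by (simp add: a_minus_def smult_r_distr smult_r_minus)
    then show ?thesis using submodule_coset_eq_iff z assms by auto
  qed
  moreover have "x \<in> U +>\<^bsub>M\<^esub> x" using assms(2) by (rule U.a_rcos_self)
  ultimately show ?thesis by blast
qed

end

lemma quot_space_simps:
  fixes M :: "('k, 'w) module"
  assumes "submodule R U M"
  shows "carrier (quot_space M U) = (\<lambda>x. U +>\<^bsub>M\<^esub> x) ` carrier M"
    "\<zero>\<^bsub>quot_space M U\<^esub> = U +>\<^bsub>M\<^esub> \<zero>\<^bsub>M\<^esub>"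
    "\<And>x y. x \<in> carrier M \<Longrightarrow> y \<in> carrier M \<Longrightarrow>
      (U +>\<^bsub>M\<^esub> x) \<oplus>\<^bsub>quot_space M U\<^esub> (U +>\<^bsub>M\<^esub> y) = U +>\<^bsub>M\<^esub> (x \<oplus>\<^bsub>M\<^esub> y)"
    "\<And>c x. c \<in> carrier R \<Longrightarrow> x \<in> carrier M \<Longrightarrow>
      c \<odot>\<^bsub>quot_space M U\<^esub> (U +>\<^bsub>M\<^esub> x) = U +>\<^bsub>M\<^esub> (c \<odot>\<^bsub>M\<^esub> x)"
proof -
  interpret module R M using assms by (simp add: submodule_def)
  interpret U: abelian_subgroup U M by (rule submodule_abelian_subgroup) fact
  show "carrier (quot_space M U) = (\<lambda>x. U +>\<^bsub>M\<^esub> x) ` carrier M"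
    by (auto simp: quot_space_def A_RCOSETS_def')
  show "\<zero>\<^bsub>quot_space M U\<^esub> = U +>\<^bsub>M\<^esub> \<zero>\<^bsub>M\<^esub>"
    using submodule.subset[OF assms] by (simp add: quot_space_def M.a_coset_add_zero)
  show "(U +>\<^bsub>M\<^esub> x) \<oplus>\<^bsub>quot_space M U\<^esub> (U +>\<^bsub>M\<^esub> y) = U +>\<^bsub>M\<^esub> (x \<oplus>\<^bsub>M\<^esub> y)"
    if "x \<in> carrier M" "y \<in> carrier M" for x y
    using that by (simp add: quot_space_def U.a_rcos_sum)
  show "c \<odot>\<^bsub>quot_space M U\<^esub> (U +>\<^bsub>M\<^esub> x) = U +>\<^bsub>M\<^esub> (c \<odot>\<^bsub>M\<^esub> x)"
    if "c \<in> carrier R" "x \<in> carrier M" for c x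
    using that coset_smult[OF assms] by (simp add: quot_space_def)
qed


lemma quot_space_vectorspace:
  fixes V :: "('k, 'w) module"
  assumes "vectorspace K V" "submodule K U V"
  shows "vectorspace K (quot_space V U)"
proof -
  interpret vectorspace K V by fact
  note [simp] = quot_space_simps[OF assms(2)]
  show ?thesis
  proof (rule vs_criteria)
    show "\<forall>v\<in>carrier (quot_space V U). \<exists>w\<in>carrier (quot_space V U).
        v \<oplus>\<^bsub>quot_space V U\<^esub> w = \<zero>\<^bsub>quot_space V U\<^esub>"
    proof
      fix v assume "v \<in> carrier (quot_space V U)"
      then obtain x where "v = U +>\<^bsub>V\<^esub> x" "x \<in> carrier V" by auto
      then show "\<exists>w\<in>carrier (quot_space V U). v \<oplus>\<^bsub>quot_space V U\<^esub> w = \<zero>\<^bsub>quot_space V U\<^esub>"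
        by (intro bexI[of _ "U +>\<^bsub>V\<^esub> (\<ominus>\<^bsub>V\<^esub> x)"]) (auto simp: M.r_neg)
    qed
    show "field K" by (rule field_axioms)
  qed (auto simp: M.a_ac smult_l_distr smult_r_distr smult_assoc1)
qed

context gr_functor
begin

context
  fixes U U' :: "('k, 'v) gr_pair \<Rightarrow> 'w set"
  assumes U: "subfunctor K X U" and U': "subfunctor K X U'"
    and sub: "\<And>A. A \<in> gr_ob K \<Longrightarrow> U A \<subseteq> U' A"
    and simple: "simple_functor K (quot_functor (sub_functor X U') U)"
begin

private abbreviation M where "M A \<equiv> (ob X A)\<lparr>carrier := U' A\<rparr>"

private lemma M_props:
  assumes "A \<in> gr_ob K"
  shows "vectorspace K (M A)" "submodule K (U A) (M A)" "U A +>\<^bsub>M A\<^esub> x = U A +>\<^bsub>ob X A\<^esub> x"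
proof -
  interpret vectorspace K "ob X A" by (rule ob_vectorspace) fact
  show vs: "vectorspace K (M A)"
    using subfunctorD(1)[OF U' assms] vectorspace_axioms
    by (intro subspace_is_vs) (simp add: subspace_def)
  show "submodule K (U A) (M A)"
    using subfunctorD(1)[OF U assms] sub[OF assms] vs
    by (auto simp: submodule_def vectorspace_def)
  show "U A +>\<^bsub>M A\<^esub> x = U A +>\<^bsub>ob X A\<^esub> x"
    by (simp add: a_r_coset_def')
qed

lemma simple_quotient_proper: "\<exists>A\<in>gr_ob K. U A \<noteq> U' A"
proof (rule ccontr)
  assume "\<not> (\<exists>A\<in>gr_ob K. U A \<noteq> U' A)"
  then have eq: "U' A = U A" if "A \<in> gr_ob K" for A using that by blast
  have "carrier (quot_space (M A) (U A)) = {U A}" if A: "A \<in> gr_ob K" for A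
  proof -
    interpret vectorspace K "M A" by (rule M_props) fact
    interpret S: abelian_subgroup "U A" "M A"
      by (rule submodule_abelian_subgroup) (rule M_props, fact)
    have "U A +>\<^bsub>M A\<^esub> x = U A" if "x \<in> U A" for x
      using that by (rule S.a_rcos_const)
    moreover have "U A \<noteq> {}" using S.zero_closed by blast
    ultimately show ?thesis
      unfolding quot_space_simps(1)[OF M_props(2)[OF A]] using eq[OF A] by auto
  qed
  then have "zero_functor K (quot_functor (sub_functor X U') U)"
    by (simp add: zero_functor_def quot_functor_def sub_functor_def quot_space_def)
  with simple show False by (simp add: simple_functor_def)
qed

text \<open>
  Subfunctors between \<open>U\<close> and \<open>U'\<close> correspond to subfunctors of the quotient. By
  simplicity the image of an intermediate subfunctor in the quotient is zero or everything, and
  the subfunctor is the preimage of its image.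
\<close>
lemma intermediate_subfunctor_trivial:
  assumes Y: "subfunctor K X Y" and UY: "\<And>A. A \<in> gr_ob K \<Longrightarrow> U A \<subseteq> Y A"
    and YU': "\<And>A. A \<in> gr_ob K \<Longrightarrow> Y A \<subseteq> U' A"
  shows "(\<forall>A\<in>gr_ob K. Y A = U A) \<or> (\<forall>A\<in>gr_ob K. Y A = U' A)"
proof -
  let ?Z = "quot_functor (sub_functor X U') U"
  let ?Y = "\<lambda>A. (\<lambda>x. U A +>\<^bsub>M A\<^esub> x) ` Y A"
  have obZ: "ob ?Z A = quot_space (M A) (U A)" for A
    by (simp add: quot_functor_def sub_functor_def)
  have "subfunctor K ?Z ?Y"
    unfolding subfunctor_def
  proof (intro conjI ballI)
    fix A :: "('k, 'v) gr_pair" assume A: "A \<in> gr_ob K"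
    interpret vectorspace K "M A" by (rule M_props) fact
    note [simp] = quot_space_simps[OF M_props(2)[OF A]]
    have Yc: "x \<in> carrier (M A)" if "x \<in> Y A" for x using that YU'[OF A] by auto
    note Ysub = subfunctorD(1)[OF Y A]
    have "submodule K (?Y A) (quot_space (M A) (U A))"
    proof (rule submodule.intro)
      show "?Y A \<subseteq> carrier (quot_space (M A) (U A))" using Yc by auto
      show "module K (quot_space (M A) (U A))"
        using quot_space_vectorspace[OF M_props(1)[OF A] M_props(2)[OF A]] by (rule vectorspace.axioms(1))
      show "\<zero>\<^bsub>quot_space (M A) (U A)\<^esub> \<in> ?Y A"
        using submodule.zero_closed[OF Ysub] by auto
      show "v \<oplus>\<^bsub>quot_space (M A) (U A)\<^esub> w \<in> ?Y A" if v: "v \<in> ?Y A" and w: "w \<in> ?Y A" for v w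
      proof -
        obtain x y where "v = U A +>\<^bsub>M A\<^esub> x" "x \<in> Y A" "w = U A +>\<^bsub>M A\<^esub> y" "y \<in> Y A"
          using v w by blast
        then show ?thesis
          using submodule.m_closed[OF Ysub] Yc by (auto simp del: M_props)
      qed
      show "c \<odot>\<^bsub>quot_space (M A) (U A)\<^esub> v \<in> ?Y A" if c: "c \<in> carrier K" and v: "v \<in> ?Y A" for c v
      proof -
        obtain x where "v = U A +>\<^bsub>M A\<^esub> x" "x \<in> Y A" using v by blast
        then show ?thesis
          using submodule.smult_closed[OF Ysub c] Yc c by auto
      qed
    qed
    then show "subspace K (?Y A) (ob ?Z A)"
      using quot_space_vectorspace[OF M_props(1)[OF A] M_props(2)[OF A]] by (simp add: subspace_def obZ)
  next
    fix A B :: "('k, 'v) gr_pair" and f assume A: "A \<in> gr_ob K" and B: "B \<in> gr_ob K" and f: "f \<in> gr_hom K A B"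
    interpret A: vectorspace K "M A" by (rule M_props) fact
    interpret B: vectorspace K "M B" by (rule M_props) fact
    interpret f: mod_hom K "ob X A" "ob X B" "mor X A B f" by (rule mod_hom_mor) fact+
    show "mor ?Z A B f ` ?Y A \<subseteq> ?Y B"
    proof
      fix C assume "C \<in> mor ?Z A B f ` ?Y A"
      then obtain x where x: "x \<in> Y A" and C: "C = mor ?Z A B f (U A +>\<^bsub>M A\<^esub> x)" by blast
      have xM: "x \<in> carrier (M A)" using x YU'[OF A] by auto
      have "U A +>\<^bsub>M A\<^esub> x \<in> carrier (quot_space (M A) (U A))"
        unfolding quot_space_simps(1)[OF M_props(2)[OF A]] using xM by blast
      then have C': "C = (\<Union>z\<in>U A +>\<^bsub>M A\<^esub> x. U B +>\<^bsub>M B\<^esub> restrict (mor X A B f) (U' A) z)"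
        unfolding C by (simp add: quot_functor_def sub_functor_def)
      \<comment> \<open>all terms of the union defining the induced map on cosets agree\<close>
      have eq: "U B +>\<^bsub>M B\<^esub> restrict (mor X A B f) (U' A) z = U B +>\<^bsub>M B\<^esub> mor X A B f x"
        if "z \<in> U A +>\<^bsub>M A\<^esub> x" for z
      proof -
        note z = A.mem_submodule_cosetD[OF M_props(2)[OF A] xM that]
        have zU': "z \<in> U' A" and xU': "x \<in> U' A" using z(1) xM by auto
        then have zX: "z \<in> carrier (ob X A)" "x \<in> carrier (ob X A)"
          using subfunctorD(2)[OF U' A] by auto
        have "z \<in> U A +>\<^bsub>ob X A\<^esub> x" using that M_props(3)[OF A] by simp
        then obtain u where u: "u \<in> U A" "z = u \<oplus>\<^bsub>ob X A\<^esub> x" by (auto simp: a_r_coset_def')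
        then have "mor X A B f z = mor X A B f u \<oplus>\<^bsub>M B\<^esub> mor X A B f x"
          using zX subfunctorD(2)[OF U A] by auto
        moreover have fu: "mor X A B f u \<in> U B" using subfunctorD(3)[OF U A B f u(1)] .
        moreover have fx: "mor X A B f x \<in> carrier (M B)"
          using subfunctorD(3)[OF U' A B f xU'] by simp
        ultimately have "mor X A B f z \<in> U B +>\<^bsub>M B\<^esub> mor X A B f x"
          by (auto simp: a_r_coset_def')
        then show ?thesis
          using B.mem_submodule_cosetD(2)[OF M_props(2)[OF B] fx] zU' by simp
      qed
      have "x \<in> U A +>\<^bsub>M A\<^esub> x"
      proof -
        interpret S: abelian_subgroup "U A" "M A"
          by (rule A.submodule_abelian_subgroup) (rule M_props, fact)
        show ?thesis using xM by (rule S.a_rcos_self)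
      qed
      then have "C = U B +>\<^bsub>M B\<^esub> mor X A B f x" unfolding C' using eq by blast
      then show "C \<in> ?Y B" using subfunctorD(3)[OF Y A B f x] by blast
    qed
  qed
  then consider "\<forall>A\<in>gr_ob K. ?Y A = {\<zero>\<^bsub>ob ?Z A\<^esub>}" | "\<forall>A\<in>gr_ob K. ?Y A = carrier (ob ?Z A)"
    using simple unfolding simple_functor_def by blast
  then show ?thesis
  proof cases
    case 1
    have "Y A \<subseteq> U A" if A: "A \<in> gr_ob K" for A
    proof
      fix x assume x: "x \<in> Y A"
      interpret vectorspace K "M A" by (rule M_props) fact
      interpret S: abelian_subgroup "U A" "M A"
        by (rule submodule_abelian_subgroup) (rule M_props, fact)
      have "U A +>\<^bsub>M A\<^esub> x = U A"
        using 1 A x by (auto simp: obZ quot_space_def)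
      moreover have "x \<in> U A +>\<^bsub>M A\<^esub> x" using x YU'[OF A] by (intro S.a_rcos_self) auto
      ultimately show "x \<in> U A" by simp
    qed
    then show ?thesis using UY by blast
  next
    case 2
    have "U' A \<subseteq> Y A" if A: "A \<in> gr_ob K" for A
    proof
      fix x assume x: "x \<in> U' A"
      interpret vectorspace K "M A" by (rule M_props) fact
      interpret S: abelian_subgroup "U A" "M A"
        by (rule submodule_abelian_subgroup) (rule M_props, fact)
      have "U A +>\<^bsub>M A\<^esub> x \<in> carrier (quot_space (M A) (U A))"
        using x unfolding quot_space_simps(1)[OF M_props(2)[OF A]] by auto
      then have "U A +>\<^bsub>M A\<^esub> x \<in> ?Y A" using 2 A unfolding obZ by blast
      then obtain y where y: "y \<in> Y A" "U A +>\<^bsub>M A\<^esub> x = U A +>\<^bsub>M A\<^esub> y" by blast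
      then have "x \<in> U A +>\<^bsub>M A\<^esub> y" using x S.a_rcos_self[of x] by simp
      then obtain u where "u \<in> U A" "x = u \<oplus>\<^bsub>ob X A\<^esub> y" by (auto simp: a_r_coset_def')
      then show "x \<in> Y A"
        using UY[OF A] y(1) submodule.m_closed[OF subfunctorD(1)[OF Y A]] by auto
    qed
    then show ?thesis using YU' by blast
  qed
qed

end

end


section \<open>Simple subquotients are polynomial\<close>

text \<open>
  A cube of morphisms which is affine pointwise. The vertices are morphisms, whereas the
  increments are linear maps that in general do not respect the distinguished subspaces.
\<close>
definition affine_family ::
  "('k, 'r) ring_scheme \<Rightarrow> ('k, 'v) gr_pair \<Rightarrow> ('k, 'v) gr_pair \<Rightarrow> 'i set \<Rightarrow>
    ('i set \<Rightarrow> 'v \<Rightarrow> 'v) \<Rightarrow> bool"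
  where "affine_family K T B D f \<longleftrightarrow>
    (\<forall>I\<subseteq>D. f I \<in> gr_hom K T B) \<and>
    (\<forall>v\<in>carrier (fst T). affine_cube (fst B) D (\<lambda>I. f I v))"

lemma affine_family_precomp:
  assumes "affine_family K T B D f" "S \<in> gr_ob K" "g \<in> gr_hom K S T"
  shows "affine_family K S B D (\<lambda>I. gr_comp S (f I) g)"
  using assms gr_comp_in_gr_hom[OF assms(2,3)] gr_homD(5)[OF assms(3)]
  by (auto simp: affine_family_def gr_comp_def compose_def)

lemma affine_family_postcomp:
  assumes "affine_family K S T D f" "S \<in> gr_ob K" "g \<in> gr_hom K T B"
  shows "affine_family K S B D (\<lambda>I. gr_comp S g (f I))"
  unfolding affine_family_def
proof (intro conjI allI impI ballI)
  show "gr_comp S g (f I) \<in> gr_hom K S B" if "I \<subseteq> D" for I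
    using assms that gr_comp_in_gr_hom[OF assms(2) _ assms(3)] by (simp add: affine_family_def)
  fix v assume v: "v \<in> carrier (fst S)"
  then have "affine_cube (fst B) D (\<lambda>I. g (f I v))"
    using affine_cube_additive_image[of "fst T" D "\<lambda>I. f I v" g "fst B"] assms(1)
      gr_homD(2,6)[OF assms(3)] by (simp add: affine_family_def)
  then show "affine_cube (fst B) D (\<lambda>I. gr_comp S g (f I) v)"
    using v by (simp add: gr_comp_def compose_def)
qed

context gr_functor
begin

text \<open>
  The function \<open>f \<mapsto> X(f) x\<close> factors through the finite set of endomorphisms of \<open>B\<close>. Two
  endomorphisms \<open>e\<close> and \<open>e'\<close> differ at some \<open>b\<close>, and the functions \<open>f \<mapsto> l (f b)\<close>, with \<open>l\<close> a linear form
  separating \<open>e b\<close> from \<open>e' b\<close>, are affine on affine families.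
\<close>
lemma deg_below_endomorphism_action:
  assumes fin: "finite (carrier K)" and B: "B \<in> gr_ob K" and W: "submodule K W (ob X B)"
    and x: "x \<in> carrier (ob X B)" and f: "affine_family K B B D f"
  shows "deg_below (ob X B) W (card (gr_hom K B B)) D (\<lambda>I. mor X B B (f I) x)"
proof -
  interpret V: vectorspace K "fst B" using gr_obD(1)[OF B] .
  interpret M: vectorspace K "ob X B" by (rule ob_vectorspace) fact
  show ?thesis
  proof (rule M.deg_below_finite_range[OF W finite_gr_hom[OF fin B B], where a = "\<lambda>g. mor X B B g x"])
    show "f I \<in> gr_hom K B B" if "I \<subseteq> D" for I using f that by (simp add: affine_family_def)
    show "(\<lambda>g. mor X B B g x) \<in> gr_hom K B B \<rightarrow> carrier (ob X B)"
      using mor_closed[OF B B _ x] by blast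
    fix e e' assume e: "e \<in> gr_hom K B B" "e' \<in> gr_hom K B B" "e \<noteq> e'"
    then obtain b where b: "b \<in> carrier (fst B)" "e b \<noteq> e' b"
      using extensionalityI[OF gr_homD(3)[OF e(1)] gr_homD(3)[OF e(2)]] by blast
    have eb: "e b \<in> carrier (fst B)" "e' b \<in> carrier (fst B)"
      using gr_homD(5)[OF e(1) b(1)] gr_homD(5)[OF e(2) b(1)] .
    obtain l where l: "l \<in> carrier (fst B) \<rightarrow> carrier K"
      "\<And>v w. v \<in> carrier (fst B) \<Longrightarrow> w \<in> carrier (fst B) \<Longrightarrow> l (v \<oplus>\<^bsub>fst B\<^esub> w) = l v \<oplus>\<^bsub>K\<^esub> l w"
      "l (e b) \<noteq> l (e' b)"
      using V.additive_form_separating[OF gr_obD(2)[OF B] eb b(2)] by blast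
    have lc: "l v \<in> carrier K" if "v \<in> carrier (fst B)" for v using l(1) that by blast
    define s where "s = l (e b) \<ominus>\<^bsub>K\<^esub> l (e' b)"
    have s: "s \<in> carrier K" "s \<noteq> \<zero>\<^bsub>K\<^esub>"
      using lc eb l(3) unfolding s_def by simp_all
    then have sU: "s \<in> Units K" by (simp add: V.field_Units)
    \<comment> \<open>normalized to the values \<open>1\<close> at \<open>e\<close> and \<open>0\<close> at \<open>e'\<close>\<close>
    let ?c = "\<lambda>g. inv\<^bsub>K\<^esub> s \<otimes>\<^bsub>K\<^esub> (l (g b) \<ominus>\<^bsub>K\<^esub> l (e' b))"
    have "affine_cube K D (\<lambda>I. l (f I b))"
      using affine_cube_additive_image[of "fst B" D "\<lambda>I. f I b" l K] f b(1) l(1,2)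
      by (simp add: affine_family_def)
    then have "affine_cube K D (\<lambda>I. ?c (f I))"
      using lc eb sU by (intro V.affine_cube_normalize) auto
    moreover have "?c \<in> gr_hom K B B \<rightarrow> carrier K"
      using lc eb sU gr_homD(5)[of _ K B B, OF _ b(1)] by auto
    moreover have "?c e = \<one>\<^bsub>K\<^esub>" using sU unfolding s_def[symmetric] by simp
    moreover have "?c e' = \<zero>\<^bsub>K\<^esub>" using lc eb sU by (simp add: a_minus_def V.R.r_neg)
    ultimately show "\<exists>c\<in>gr_hom K B B \<rightarrow> carrier K. c e = \<one>\<^bsub>K\<^esub> \<and> c e' = \<zero>\<^bsub>K\<^esub> \<and>
        affine_cube K D (\<lambda>I. c (f I))" by (intro bexI[of _ ?c]) simp_all
  qed
qed

text \<open>
  The maps \<open>m I\<close> are to be thought of as the masks of \<open>T = V \<oplus> K\<^bsup>card D\<^esup>\<close>; what matters is that they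
  form an affine family starting at the identity, and that all the others kill \<open>y\<close>. The bound
  \<open>N\<close> depends only on the object at which the subquotient is tested to be nonzero.
\<close>
lemma simple_quotient_polynomial:
  assumes fin: "finite (carrier K)"
    and U: "subfunctor K X U" and U': "subfunctor K X U'"
    and sub: "\<And>A. A \<in> gr_ob K \<Longrightarrow> U A \<subseteq> U' A"
    and simple: "simple_functor K (quot_functor (sub_functor X U') U)"
  shows "\<exists>N. \<forall>T m y (D :: nat set). T \<in> gr_ob K \<longrightarrow> y \<in> U' T \<longrightarrow> finite D \<longrightarrow> N \<le> card D \<longrightarrow>
    affine_family K T T D m \<longrightarrow> m {} = gr_id T \<longrightarrow>
    (\<forall>I\<subseteq>D. I \<noteq> {} \<longrightarrow> mor X T T (m I) y = \<zero>\<^bsub>ob X T\<^esub>) \<longrightarrow> y \<in> U T"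
proof -
  have trivial: "(\<forall>A\<in>gr_ob K. Y A = U A) \<or> (\<forall>A\<in>gr_ob K. Y A = U' A)"
    if "subfunctor K X Y" "\<And>A. A \<in> gr_ob K \<Longrightarrow> U A \<subseteq> Y A" "\<And>A. A \<in> gr_ob K \<Longrightarrow> Y A \<subseteq> U' A" for Y
    by (rule intermediate_subfunctor_trivial[OF U U' _ simple]) (use sub that in auto)
  obtain B where B: "B \<in> gr_ob K" "U B \<noteq> U' B"
    using simple_quotient_proper[OF U U' sub simple] by blast
  then obtain x where x: "x \<in> U' B" "x \<notin> U B" using sub by blast
  have UB: "submodule K (U B) (ob X B)" using subfunctorD(1)[OF U B(1)] .
  interpret MB: vectorspace K "ob X B" by (rule ob_vectorspace) fact
  define N where "N = card (gr_hom K B B)"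
  \<comment> \<open>\<open>P\<close>: elements of polynomial behaviour modulo \<open>U\<close>; \<open>Z\<close>: elements invisible at \<open>B\<close> modulo \<open>U\<close>.
    Both are subfunctors containing \<open>U\<close>, and \<open>x\<close> lies in the first but not in the second.\<close>
  define P where "P T = {y \<in> carrier (ob X T). \<forall>(D :: nat set) f. affine_family K T B D f \<longrightarrow>
    deg_below (ob X B) (U B) N D (\<lambda>I. mor X T B (f I) y)}" for T
  define Z where "Z T = {y \<in> carrier (ob X T). \<forall>f\<in>gr_hom K T B. mor X T B f y \<in> U B}" for T

  have PD: "deg_below (ob X B) (U B) N D (\<lambda>I. mor X T B (f I) y)"
    if "y \<in> P T" "affine_family K T B D f" for T y f and D :: "nat set"
    using that unfolding P_def by blast
  have famD: "f I \<in> gr_hom K T B" if "affine_family K T B D f" "I \<subseteq> D" for T f I and D :: "nat set"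
    using that unfolding affine_family_def by blast

  have P_sub: "submodule K (P T) (ob X T)" if T: "T \<in> gr_ob K" for T
  proof (rule submodule.intro)
    interpret T: vectorspace K "ob X T" by (rule ob_vectorspace) fact
    have h: "mod_hom K (ob X T) (ob X B) (mor X T B (f I))"
      if "affine_family K T B D f" "I \<subseteq> D" for f I and D :: "nat set"
      using mod_hom_mor[OF T B(1) famD[OF that]] .
    show "module K (ob X T)" by (rule T.module_axioms)
    show "P T \<subseteq> carrier (ob X T)" unfolding P_def by blast
    show "v \<oplus>\<^bsub>ob X T\<^esub> w \<in> P T" if v: "v \<in> P T" and w: "w \<in> P T" for v w
    proof -
      have vw: "v \<in> carrier (ob X T)" "w \<in> carrier (ob X T)" using v w unfolding P_def by blast+
      have "deg_below (ob X B) (U B) N D (\<lambda>I. mor X T B (f I) (v \<oplus>\<^bsub>ob X T\<^esub> w))"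
        if f: "affine_family K T B D f" for f and D :: "nat set"
      proof -
        have "deg_below (ob X B) (U B) N D (\<lambda>I. mor X T B (f I) v \<oplus>\<^bsub>ob X B\<^esub> mor X T B (f I) w)"
          using mod_hom.f_im[OF h[OF f]] vw
          by (intro MB.deg_below_add[OF UB PD[OF v f] PD[OF w f]]) auto
        then show ?thesis
          using module_hom_add[OF mod_hom.f_hom[OF h[OF f]]] vw
          by (subst deg_below_cong[of D _ "\<lambda>I. mor X T B (f I) v \<oplus>\<^bsub>ob X B\<^esub> mor X T B (f I) w"]) auto
      qed
      then show ?thesis using vw unfolding P_def by simp
    qed
    show "\<zero>\<^bsub>ob X T\<^esub> \<in> P T"
    proof -
      have "deg_below (ob X B) (U B) N D (\<lambda>I. mor X T B (f I) \<zero>\<^bsub>ob X T\<^esub>)"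
        if f: "affine_family K T B D f" for f and D :: "nat set"
      proof -
        have "deg_below (ob X B) (U B) 0 D (\<lambda>I. \<zero>\<^bsub>ob X B\<^esub>)"
          using submodule.zero_closed[OF UB] by simp
        then have "deg_below (ob X B) (U B) N D (\<lambda>I. \<zero>\<^bsub>ob X B\<^esub>)"
          by (rule MB.deg_below_mono[OF UB]) simp
        then show ?thesis
          using mod_hom.f0_is_0[OF h[OF f]]
          by (subst deg_below_cong[of D _ "\<lambda>I. \<zero>\<^bsub>ob X B\<^esub>"]) auto
      qed
      then show ?thesis unfolding P_def by simp
    qed
    show "c \<odot>\<^bsub>ob X T\<^esub> v \<in> P T" if c: "c \<in> carrier K" and v: "v \<in> P T" for c v
    proof -
      have vT: "v \<in> carrier (ob X T)" using v unfolding P_def by blast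
      have "deg_below (ob X B) (U B) N D (\<lambda>I. mor X T B (f I) (c \<odot>\<^bsub>ob X T\<^esub> v))"
        if f: "affine_family K T B D f" for f and D :: "nat set"
      proof -
        have "deg_below (ob X B) (U B) N D (\<lambda>I. c \<odot>\<^bsub>ob X B\<^esub> mor X T B (f I) v)"
          using mod_hom.f_im[OF h[OF f]] vT
          by (intro MB.deg_below_smult[OF UB c PD[OF v f]]) auto
        then show ?thesis
          using module_hom_smult[OF mod_hom.f_hom[OF h[OF f]]] vT c
          by (subst deg_below_cong[of D _ "\<lambda>I. c \<odot>\<^bsub>ob X B\<^esub> mor X T B (f I) v"]) auto
      qed
      then show ?thesis using vT c unfolding P_def by simp
    qed
  qed
  have P_mor: "mor X S T g y \<in> P T"
    if S: "S \<in> gr_ob K" and T: "T \<in> gr_ob K" and g: "g \<in> gr_hom K S T" and y: "y \<in> P S" for S T g y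
  proof -
    have yS: "y \<in> carrier (ob X S)" using y unfolding P_def by blast
    have "deg_below (ob X B) (U B) N D (\<lambda>I. mor X T B (f I) (mor X S T g y))"
      if f: "affine_family K T B D f" for f and D :: "nat set"
    proof -
      have "deg_below (ob X B) (U B) N D (\<lambda>I. mor X S B (gr_comp S (f I) g) y)"
        by (rule PD[OF y affine_family_precomp[OF f S g]])
      then show ?thesis
        using mor_comp_apply[OF S T B(1) g famD[OF f] yS]
        by (subst deg_below_cong[of D _ "\<lambda>I. mor X S B (gr_comp S (f I) g) y"]) auto
    qed
    then show ?thesis using mor_closed[OF S T g yS] unfolding P_def by simp
  qed
  have UD: "U T \<subseteq> P T" if T: "T \<in> gr_ob K" for T
  proof
    fix y assume y: "y \<in> U T"
    have "deg_below (ob X B) (U B) N D (\<lambda>I. mor X T B (f I) y)"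
      if f: "affine_family K T B D f" for f and D :: "nat set"
    proof (rule MB.deg_below_mono[OF UB])
      show "deg_below (ob X B) (U B) 0 D (\<lambda>I. mor X T B (f I) y)"
        using subfunctorD(3)[OF U T B(1) famD[OF f] y] by simp
    qed simp
    then show "y \<in> P T" using y subfunctorD(2)[OF U T] unfolding P_def by blast
  qed
  have xP: "x \<in> P B"
    using deg_below_endomorphism_action[OF fin B(1) UB] x(1) subfunctorD(2)[OF U' B(1)]
    unfolding P_def N_def by blast
  have "subfunctor K X (\<lambda>T. P T \<inter> U' T)"
    unfolding subfunctor_def
  proof (intro conjI ballI)
    show "subspace K (P T \<inter> U' T) (ob X T)" if "T \<in> gr_ob K" for T
      using P_sub[OF that] subfunctorD(1)[OF U' that] ob_vectorspace[OF that]
      by (auto simp: subspace_def submodule_def)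
    show "mor X S T g ` (P S \<inter> U' S) \<subseteq> P T \<inter> U' T"
      if "S \<in> gr_ob K" "T \<in> gr_ob K" "g \<in> gr_hom K S T" for S T g
      using P_mor[OF that] subfunctorD(3)[OF U' that] by blast
  qed
  from trivial[OF this] have U'P: "U' T \<subseteq> P T" if "T \<in> gr_ob K" for T
    using UD sub x xP B(1) that by blast

  have "subfunctor K X (\<lambda>T. Z T \<inter> U' T)"
    unfolding subfunctor_def
  proof (intro conjI ballI)
    show "subspace K (Z T \<inter> U' T) (ob X T)" if T: "T \<in> gr_ob K" for T
    proof -
      interpret T: vectorspace K "ob X T" by (rule ob_vectorspace) fact
      have h: "mod_hom K (ob X T) (ob X B) (mor X T B f)" if "f \<in> gr_hom K T B" for f
        using mod_hom_mor[OF T B(1) that] .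
      have "submodule K (Z T) (ob X T)"
      proof (rule submodule.intro)
        show "module K (ob X T)" by (rule T.module_axioms)
        show "v \<oplus>\<^bsub>ob X T\<^esub> w \<in> Z T" if "v \<in> Z T" "w \<in> Z T" for v w
          using that module_hom_add[OF mod_hom.f_hom[OF h]] submodule.m_closed[OF UB]
          unfolding Z_def by simp
        show "\<zero>\<^bsub>ob X T\<^esub> \<in> Z T"
          using mod_hom.f0_is_0[OF h] submodule.zero_closed[OF UB] unfolding Z_def by simp
        show "c \<odot>\<^bsub>ob X T\<^esub> v \<in> Z T" if "c \<in> carrier K" "v \<in> Z T" for c v
          using that module_hom_smult[OF mod_hom.f_hom[OF h]] submodule.smult_closed[OF UB]
          unfolding Z_def by simp
      qed (auto simp: Z_def)
      then show ?thesis
        using subfunctorD(1)[OF U' T] T.vectorspace_axioms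
        by (auto simp: subspace_def submodule_def)
    qed
    show "mor X S T g ` (Z S \<inter> U' S) \<subseteq> Z T \<inter> U' T"
      if S: "S \<in> gr_ob K" and T: "T \<in> gr_ob K" and g: "g \<in> gr_hom K S T" for S T g
    proof (intro subsetI IntI)
      fix z assume "z \<in> mor X S T g ` (Z S \<inter> U' S)"
      then obtain y where y: "y \<in> Z S" "y \<in> U' S" "z = mor X S T g y" by blast
      then have yS: "y \<in> carrier (ob X S)" unfolding Z_def by blast
      show "z \<in> U' T" using subfunctorD(3)[OF U' S T g y(2)] y(3) by simp
      have "mor X T B f z \<in> U B" if f: "f \<in> gr_hom K T B" for f
        using y(1) gr_comp_in_gr_hom[OF S g f] mor_comp_apply[OF S T B(1) g f yS]
        unfolding y(3) Z_def by auto
      then show "z \<in> Z T" using mor_closed[OF S T g yS] y(3) unfolding Z_def by blast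
    qed
  qed
  moreover have "U T \<subseteq> Z T \<inter> U' T" if T: "T \<in> gr_ob K" for T
    using sub[OF T] subfunctorD(2)[OF U T] subfunctorD(3)[OF U T B(1)] unfolding Z_def by blast
  moreover have "x \<notin> Z B"
  proof
    assume "x \<in> Z B"
    then have "mor X B B (gr_id B) x \<in> U B" using gr_id_in_gr_hom[OF B(1)] unfolding Z_def by blast
    then show False
      using x subfunctorD(2)[OF U' B(1)] by (auto simp: mor_id[OF B(1)])
  qed
  ultimately have ZU: "Z T \<inter> U' T = U T" if "T \<in> gr_ob K" for T
    using trivial[of "\<lambda>T. Z T \<inter> U' T"] x(1) B(1) that by blast

  show ?thesis
  proof (intro exI[of _ N] allI impI)
    fix T m y and D :: "nat set"
    assume T: "T \<in> gr_ob K" and y: "y \<in> U' T" and D: "finite D" "N \<le> card D"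
      and m: "affine_family K T T D m" "m {} = gr_id T"
      and kill: "\<forall>I\<subseteq>D. I \<noteq> {} \<longrightarrow> mor X T T (m I) y = \<zero>\<^bsub>ob X T\<^esub>"
    have yT: "y \<in> carrier (ob X T)" using y subfunctorD(2)[OF U' T] by blast
    have "mor X T B f y \<in> U B" if f: "f \<in> gr_hom K T B" for f
    proof -
      let ?G = "\<lambda>I. mor X T B (gr_comp T f (m I)) y"
      have G: "?G I = mor X T B f (mor X T T (m I) y)" if "I \<subseteq> D" for I
        using mor_comp_apply[OF T T B(1) _ f yT] m(1) that unfolding affine_family_def by blast
      have G0: "?G {} = mor X T B f y"
        using G[of "{}"] m(2) mor_id[OF T] yT by simp
      have "?G {} \<in> U B"
      proof (rule MB.deg_below_concentrated[OF UB _ D])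
        show "deg_below (ob X B) (U B) N D ?G"
          using U'P[OF T] y by (intro PD affine_family_postcomp[OF m(1) T f]) blast
        show "?G {} \<in> carrier (ob X B)" unfolding G0 by (rule mor_closed[OF T B(1) f yT])
        show "?G I \<in> U B" if "I \<subseteq> D" "I \<noteq> {}" for I
          using G[OF that(1)] kill that mod_hom.f0_is_0[OF mod_hom_mor[OF T B(1) f]]
            submodule.zero_closed[OF UB] by simp
      qed
      then show ?thesis unfolding G0 .
    qed
    then have "y \<in> Z T" using yT unfolding Z_def by blast
    then show "y \<in> U T" using ZU[OF T] y by blast
  qed
qed

end

section \<open>Iterated differences\<close>

lemma ob_diff_functor:
  "ob (diff_functor K Z) A = (ob Z (adjoin_ob K A))\<lparr>carrier := diff_kernel K Z A\<rparr>"
  by (simp add: diff_functor_def)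

lemma mor_diff_functor:
  "y \<in> diff_kernel K Z A \<Longrightarrow> mor (diff_functor K Z) A B f y =
    mor Z (adjoin_ob K A) (adjoin_ob K B) (adjoin_mor K A f) y"
  by (simp add: diff_functor_def)

text \<open>
  The \<open>n\<close>-th difference at \<open>(V, W)\<close> is carried by a subset of \<open>X(V \<oplus> K\<^sup>n, W)\<close>, with the operations
  and (see \<open>mor_diff_functor_iter\<close>) the morphisms of \<open>X\<close>.
\<close>
lemma ob_diff_functor_iter:
  "ob ((diff_functor K ^^ n) X) A =
    (ob X ((adjoin_ob K ^^ n) A))\<lparr>carrier := carrier (ob ((diff_functor K ^^ n) X) A)\<rparr>"
proof (induction n arbitrary: A)
  case (Suc n)
  have "ob ((diff_functor K ^^ Suc n) X) A =
      (ob ((diff_functor K ^^ n) X) (adjoin_ob K A))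
        \<lparr>carrier := carrier (ob ((diff_functor K ^^ Suc n) X) A)\<rparr>"
    by (simp add: ob_diff_functor)
  also have "\<dots> = (ob X ((adjoin_ob K ^^ n) (adjoin_ob K A)))
        \<lparr>carrier := carrier (ob ((diff_functor K ^^ Suc n) X) A)\<rparr>"
    by (subst Suc.IH) simp
  finally show ?case by (simp add: funpow_swap1)
qed simp

lemma zero_diff_functor_iter:
  "\<zero>\<^bsub>ob ((diff_functor K ^^ n) X) A\<^esub> = \<zero>\<^bsub>ob X ((adjoin_ob K ^^ n) A)\<^esub>"
  by (subst ob_diff_functor_iter) simp

lemma carrier_diff_functor_iter_Suc:
  "y \<in> carrier (ob ((diff_functor K ^^ Suc n) X) A) \<longleftrightarrow>
    y \<in> carrier (ob ((diff_functor K ^^ n) X) (adjoin_ob K A)) \<and>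
    mor ((diff_functor K ^^ n) X) (adjoin_ob K A) A (adjoin_proj K A) y =
      \<zero>\<^bsub>ob X ((adjoin_ob K ^^ n) A)\<^esub>"
  by (simp add: ob_diff_functor diff_kernel_def a_kernel_def' zero_diff_functor_iter)

lemma carrier_diff_functor_iter_subset:
  "carrier (ob ((diff_functor K ^^ n) X) A) \<subseteq> carrier (ob X ((adjoin_ob K ^^ n) A))"
proof (induction n arbitrary: A)
  case (Suc n)
  show ?case
  proof
    fix y assume "y \<in> carrier (ob ((diff_functor K ^^ Suc n) X) A)"
    then have "y \<in> carrier (ob ((diff_functor K ^^ n) X) (adjoin_ob K A))"
      unfolding carrier_diff_functor_iter_Suc ..
    from subsetD[OF Suc.IH this] show "y \<in> carrier (ob X ((adjoin_ob K ^^ Suc n) A))"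
      by (simp add: funpow_swap1)
  qed
qed simp

lemma mor_diff_functor_iter:
  "y \<in> carrier (ob ((diff_functor K ^^ n) X) A) \<Longrightarrow>
    mor ((diff_functor K ^^ n) X) A B f y =
      mor X ((adjoin_ob K ^^ n) A) ((adjoin_ob K ^^ n) B) (adjoin_mor_iter K n A f) y"
proof (induction n arbitrary: A B f)
  case 0
  then show ?case by simp
next
  case (Suc n)
  have "y \<in> diff_kernel K ((diff_functor K ^^ n) X) A"
    using Suc.prems by (simp add: ob_diff_functor)
  then have "mor ((diff_functor K ^^ Suc n) X) A B f y =
      mor ((diff_functor K ^^ n) X) (adjoin_ob K A) (adjoin_ob K B) (adjoin_mor K A f) y"
    by (simp add: mor_diff_functor)
  also have "\<dots> = mor X ((adjoin_ob K ^^ n) (adjoin_ob K A)) ((adjoin_ob K ^^ n) (adjoin_ob K B))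
      (adjoin_mor_iter K n (adjoin_ob K A) (adjoin_mor K A f)) y"
    using Suc.prems unfolding carrier_diff_functor_iter_Suc by (intro Suc.IH) blast
  finally show ?case
    unfolding adjoin_mor_iter_Suc by (simp add: funpow_swap1)
qed

context
  fixes K :: "('k, 'r) ring_scheme" and X :: "('k, ('u, 'k) vec_univ, 'w) gr_functor"
  assumes finite_field: "finite (carrier K)" and X: "gr_functor K X"
begin

text \<open>
  By induction, an element of the difference of order \<open>n + 1\<close> lies in the \<open>n\<close>-th difference at
  \<open>V \<oplus> K\<close>, which accounts for all coordinates but the first, and is killed by forgetting the
  first coordinate.
\<close>
lemma diff_functor_iter_killed:
  "A \<in> gr_ob K \<Longrightarrow> y \<in> carrier (ob ((diff_functor K ^^ n) X) A) \<Longrightarrow> j < n \<Longrightarrow>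
    mor X ((adjoin_ob K ^^ n) A) ((adjoin_ob K ^^ n) A) (mask K A n {j}) y =
      \<zero>\<^bsub>ob X ((adjoin_ob K ^^ n) A)\<^esub>"
proof (induction n arbitrary: A j)
  case (Suc n)
  interpret gr_functor K X by (rule X)
  have swap: "(adjoin_ob K ^^ n) (adjoin_ob K A) = (adjoin_ob K ^^ Suc n) A"
    by (simp add: funpow_swap1)
  have y: "y \<in> carrier (ob ((diff_functor K ^^ n) X) (adjoin_ob K A))"
    "mor ((diff_functor K ^^ n) X) (adjoin_ob K A) A (adjoin_proj K A) y =
      \<zero>\<^bsub>ob X ((adjoin_ob K ^^ n) A)\<^esub>"
    using Suc.prems(2) unfolding carrier_diff_functor_iter_Suc by blast+
  have adA: "adjoin_ob K A \<in> gr_ob K"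
    using adjoin_ob_in_gr_ob[OF finite_field Suc.prems(1)] .
  show ?case
  proof (cases j)
    case (Suc i)
    then show ?thesis
      using Suc.IH[OF adA y(1), of i] Suc.prems(3)
      unfolding swap mask_shift by simp
  next
    case 0
    note An = adjoin_ob_iter_in_gr_ob[OF finite_field Suc.prems(1)]
    have pr: "adjoin_mor_iter K n (adjoin_ob K A) (adjoin_proj K A) \<in>
        gr_hom K ((adjoin_ob K ^^ Suc n) A) ((adjoin_ob K ^^ n) A)"
      using adjoin_mor_iter_in_gr_hom[OF finite_field adA Suc.prems(1)
        adjoin_proj_in_gr_hom[OF Suc.prems(1)], of n] unfolding swap .
    have inc: "adjoin_mor_iter K n A (adjoin_incl K A) \<in>
        gr_hom K ((adjoin_ob K ^^ n) A) ((adjoin_ob K ^^ Suc n) A)"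
      using adjoin_mor_iter_in_gr_hom[OF finite_field Suc.prems(1) adA
        adjoin_incl_in_gr_hom[OF Suc.prems(1)], of n] unfolding swap .
    have yc: "y \<in> carrier (ob X ((adjoin_ob K ^^ Suc n) A))"
      using subsetD[OF carrier_diff_functor_iter_subset Suc.prems(2)] .
    have "mor X ((adjoin_ob K ^^ Suc n) A) ((adjoin_ob K ^^ n) A)
        (adjoin_mor_iter K n (adjoin_ob K A) (adjoin_proj K A)) y = \<zero>\<^bsub>ob X ((adjoin_ob K ^^ n) A)\<^esub>"
      using mor_diff_functor_iter[OF y(1)] y(2) unfolding swap by simp
    then show ?thesis
      unfolding 0 mask_first[OF finite_field Suc.prems(1)]
        mor_comp_apply[OF An An An pr inc yc]
      using mod_hom.f0_is_0[OF mod_hom_mor[OF An An inc]] by simp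
  qed
qed simp

lemma zero_in_diff_functor_iter:
  "A \<in> gr_ob K \<Longrightarrow>
    \<zero>\<^bsub>ob X ((adjoin_ob K ^^ n) A)\<^esub> \<in> carrier (ob ((diff_functor K ^^ n) X) A)"
proof (induction n arbitrary: A)
  case 0
  interpret gr_functor K X by (rule X)
  interpret vectorspace K "ob X A" by (rule ob_vectorspace) fact
  show ?case by simp
next
  case (Suc n)
  interpret gr_functor K X by (rule X)
  have swap: "(adjoin_ob K ^^ n) (adjoin_ob K A) = (adjoin_ob K ^^ Suc n) A"
    by (simp add: funpow_swap1)
  have adA: "adjoin_ob K A \<in> gr_ob K"
    using adjoin_ob_in_gr_ob[OF finite_field Suc.prems] .
  note An = adjoin_ob_iter_in_gr_ob[OF finite_field Suc.prems]
  have pr: "adjoin_mor_iter K n (adjoin_ob K A) (adjoin_proj K A) \<in>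
      gr_hom K ((adjoin_ob K ^^ Suc n) A) ((adjoin_ob K ^^ n) A)"
    using adjoin_mor_iter_in_gr_hom[OF finite_field adA Suc.prems
      adjoin_proj_in_gr_hom[OF Suc.prems], of n] unfolding swap .
  have z: "\<zero>\<^bsub>ob X ((adjoin_ob K ^^ Suc n) A)\<^esub> \<in> carrier (ob ((diff_functor K ^^ n) X) (adjoin_ob K A))"
    using Suc.IH[OF adA] unfolding swap .
  show ?case
    unfolding carrier_diff_functor_iter_Suc
    using z mor_diff_functor_iter[OF z] mod_hom.f0_is_0[OF mod_hom_mor[OF An An pr]]
    unfolding swap by simp
qed

lemma affine_family_mask:
  assumes "A \<in> gr_ob K"
  shows "affine_family K ((adjoin_ob K ^^ n) A) ((adjoin_ob K ^^ n) A) D (mask K A n)"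
  using mask_in_gr_hom[OF finite_field assms] affine_cube_mask[OF assms]
  by (simp add: affine_family_def)

lemma diff_functor_iter_killed_mask:
  assumes A: "A \<in> gr_ob K" and y: "y \<in> carrier (ob ((diff_functor K ^^ n) X) A)"
    and I: "I \<subseteq> {..<n}" "I \<noteq> {}"
  shows "mor X ((adjoin_ob K ^^ n) A) ((adjoin_ob K ^^ n) A) (mask K A n I) y =
      \<zero>\<^bsub>ob X ((adjoin_ob K ^^ n) A)\<^esub>"
proof -
  interpret gr_functor K X by (rule X)
  let ?T = "(adjoin_ob K ^^ n) A"
  note T = adjoin_ob_iter_in_gr_ob[OF finite_field A]
  note mask = mask_in_gr_hom[OF finite_field A]
  obtain j where j: "j \<in> I" using I by blast
  have "mask K A n I = gr_comp ?T (mask K A n I) (mask K A n {j})"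
  proof (rule extensionalityI[of _ "carrier (fst ?T)"])
    show "mask K A n I v = gr_comp ?T (mask K A n I) (mask K A n {j}) v"
      if "v \<in> carrier (fst ?T)" for v
      using that mask_mask[OF finite_field A that, of I "{j}"] j
      by (simp add: gr_comp_def compose_def insert_absorb)
  qed (use gr_homD(3)[OF mask] in \<open>auto simp: gr_comp_def compose_def\<close>)
  moreover have "y \<in> carrier (ob X ?T)"
    using subsetD[OF carrier_diff_functor_iter_subset y] .
  moreover have "mor X ?T ?T (mask K A n {j}) y = \<zero>\<^bsub>ob X ?T\<^esub>"
    using diff_functor_iter_killed[OF A y] j I by auto
  ultimately show ?thesis
    using mor_comp_apply[OF T T T mask[of n "{j}"] mask[of n I], of y]
      mod_hom.f0_is_0[OF mod_hom_mor[OF T T mask[of n I]]] by simp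
qed

end

theorem proposition5:
  fixes K :: "('k, 'r) ring_scheme"
    and X :: "('k, ('u, 'k) vec_univ, 'w) gr_functor"
  assumes "field K" and "finite (carrier K)"
    and "gr_functor K X"
    and "finite_object K X"
  shows "polynomial_functor K X"
proof -
  interpret gr_functor K X by fact
  note fin = \<open>finite (carrier K)\<close>
  obtain r F where chain: "\<forall>i\<le>r. subfunctor K X (F i)"
      "\<forall>A\<in>gr_ob K. F 0 A = {\<zero>\<^bsub>ob X A\<^esub>}" "\<forall>A\<in>gr_ob K. F r A = carrier (ob X A)"
      "\<forall>i<r. (\<forall>A\<in>gr_ob K. F i A \<subseteq> F (Suc i) A) \<and>
        simple_functor K (quot_functor (sub_functor X (F (Suc i))) (F i))"
    using \<open>finite_object K X\<close> unfolding finite_object_def by (elim exE conjE) (rule that)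
  have "\<exists>N. \<forall>T m y (D :: nat set). T \<in> gr_ob K \<longrightarrow> y \<in> F (Suc i) T \<longrightarrow> finite D \<longrightarrow> N \<le> card D \<longrightarrow>
      affine_family K T T D m \<longrightarrow> m {} = gr_id T \<longrightarrow>
      (\<forall>I\<subseteq>D. I \<noteq> {} \<longrightarrow> mor X T T (m I) y = \<zero>\<^bsub>ob X T\<^esub>) \<longrightarrow> y \<in> F i T" if "i < r" for i
    using that chain(1,4) by (intro simple_quotient_polynomial[OF fin]) auto
  then obtain N where N: "\<And>i T m y (D :: nat set). i < r \<Longrightarrow> T \<in> gr_ob K \<Longrightarrow> y \<in> F (Suc i) T \<Longrightarrow>
      finite D \<Longrightarrow> N i \<le> card D \<Longrightarrow> affine_family K T T D m \<Longrightarrow> m {} = gr_id T \<Longrightarrow>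
      (\<And>I. I \<subseteq> D \<Longrightarrow> I \<noteq> {} \<Longrightarrow> mor X T T (m I) y = \<zero>\<^bsub>ob X T\<^esub>) \<Longrightarrow> y \<in> F i T"
    by metis
  define n where "n = (\<Sum>i<r. N i)"
  have "carrier (ob ((diff_functor K ^^ n) X) A) = {\<zero>\<^bsub>ob ((diff_functor K ^^ n) X) A\<^esub>}"
    if A: "A \<in> gr_ob K" for A
  proof -
    let ?T = "(adjoin_ob K ^^ n) A"
    note T = adjoin_ob_iter_in_gr_ob[OF fin A, of n]
    have "y = \<zero>\<^bsub>ob X ?T\<^esub>" if y: "y \<in> carrier (ob ((diff_functor K ^^ n) X) A)" for y
    proof -
      have "mask K A n {} = gr_id ?T"
      proof (rule extensionalityI)
        show "mask K A n {} \<in> extensional (carrier (fst ?T))"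
          by (rule gr_homD(3)[OF mask_in_gr_hom[OF fin A]])
        show "gr_id ?T \<in> extensional (carrier (fst ?T))" by (simp add: gr_id_def)
        show "mask K A n {} v = gr_id ?T v" if "v \<in> carrier (fst ?T)" for v
          using mask_empty[OF that] that by (simp add: gr_id_def)
      qed
      have down: "y \<in> F i ?T" if "i < r" "y \<in> F (Suc i) ?T" for i
      proof (rule N[OF that(1) T that(2), of "{..<n}" "mask K A n"])
        show "N i \<le> card {..<n}"
          using member_le_sum[of i "{..<r}" N] that(1) by (simp add: n_def)
        show "affine_family K ?T ?T {..<n} (mask K A n)"
          by (rule affine_family_mask[OF fin \<open>gr_functor K X\<close> A])
        show "mor X ?T ?T (mask K A n I) y = \<zero>\<^bsub>ob X ?T\<^esub>" if "I \<subseteq> {..<n}" "I \<noteq> {}" for I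
          using diff_functor_iter_killed_mask[OF fin \<open>gr_functor K X\<close> A y that] .
      qed (use \<open>mask K A n {} = gr_id ?T\<close> in simp_all)
      have "y \<in> F r ?T"
        using subsetD[OF carrier_diff_functor_iter_subset y] chain(3) T by simp
      then have "y \<in> F 0 ?T"
        using down by (induction r) auto
      then show ?thesis using chain(2) T by simp
    qed
    then show ?thesis
      unfolding zero_diff_functor_iter using zero_in_diff_functor_iter[OF fin \<open>gr_functor K X\<close> A, of n] by blast
  qed
  then show ?thesis unfolding polynomial_functor_def zero_functor_def by blast
qed

end
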